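(* (Hermite reduction.) Let $\mathbf{Z}$ be a Prüfer domain with field of fractions $\mathbf{K}$, having a divisibility test and an algorithm for inverting finitely generated ideals. Let $A=((\mathfrak{h}_i)_{1\le i\le n};(\mathfrak{e}_j)_{1\le j\le m};\underline{A})$, with $\underline{A}=(a_{ij})\in \mathbf{K}^{n\times m}$, be a pseudo-matrix over $\mathbf{Z}$ (so $a_{ij}\mathfrak{e}_j\subseteq\mathfrak{h}_i$ for all $i,j$). Then one can compute (in particular there exist) an invertible pseudo-matrix $C=((\mathfrak{e}_j)_{1\le j\le m};(\mathfrak{e}'_j)_{1\le j\le m};\underline{C})$ with $\underline{C}\in\mathbf{K}^{m\times m}$, and a permutation matrix $\underline{L}\in\mathbf{Z}^{n\times n}$, with corresponding pseudo-matrix $L$ (the one permuting the rows of $A$ together with their indexing ideals $\mathfrak{h}_i$), such that the matrix of the product $LAC$ is in reduced Hermite form, i.e. of the block form $$\begin{bmatrix} T & 0\\ G & 0\end{bmatrix}$$ where $T$ is a square lower triangular matrix with nonzero determinant (some blocks may be empty).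
   Context: A Prüfer domain is an integral domain $\mathbf{Z}$ in which every nonzero finitely generated ideal is invertible. Fractional ideals are finitely generated $\mathbf{Z}$-submodules of $\mathbf{K}=\mathrm{Frac}(\mathbf{Z})$; a fractional ideal $\mathfrak{a}$ is invertible if $\mathfrak{a}\mathfrak{b}=\mathbf{Z}$ for some fractional ideal $\mathfrak{b}=\mathfrak{a}^{-1}$. A pseudo-matrix over $\mathbf{Z}$ is a triple $M=(\mathfrak{h}_1,\dots,\mathfrak{h}_n;\mathfrak{e}_1,\dots,\mathfrak{e}_m;\underline{M})$ with $\mathfrak{h}_i$ (row indices) and $\mathfrak{e}_j$ (column indices) invertible fractional ideals and $\underline{M}=(m_{ij})\in\mathbf{K}^{n\times m}$ satisfying $m_{ij}\mathfrak{e}_j\subseteq\mathfrak{h}_i$ for all $i,j$. It represents the $\mathbf{Z}$-linear map $\mathfrak{e}_1\times\cdots\times\mathfrak{e}_m\to\mathfrak{h}_1\times\cdots\times\mathfrak{h}_n$, $x\mapsto\underline{M}x$. The product is $(\underline{\mathfrak{c}};\underline{\mathfrak{h}};\underline{B})\cdot(\underline{\mathfrak{h}};\underline{\mathfrak{e}};\underline{A})=(\underline{\mathfrak{c}};\underline{\mathfrak{e}};\underline{B}\,\underline{A})$. A pseudo-matrix $(\underline{\mathfrak{h}};\underline{\mathfrak{e}};\underline{M})$ with as many rows as columns is invertible if $\underline{M}$ is invertible and $(\underline{\mathfrak{e}};\underline{\mathfrak{h}};\underline{M}^{-1})$ is a pseudo-matrix. "One can compute" means existence together with an algorithm, given the algorithms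 assumed for $\mathbf{Z}$. *)

theory Defs
  imports "Jordan_Normal_Form.Determinant"
begin

section \<open>Fractional ideals and Pruefer domains\<close>

text \<open>
  The domain \<open>Z\<close> is a type \<open>'z :: idom\<close>, its field of fractions \<open>K\<close> is \<open>'z fract\<close>, and the
  canonical embedding is \<open>to_fract\<close>.  The two interpretations provide \<open>Z\<close>-submodules of \<open>Z\<close>
  (that is, ideals) and of \<open>K\<close>.
\<close>

global_interpretation int_ideal: Modules.module "(*) :: 'z::idom \<Rightarrow> 'z \<Rightarrow> 'z"
  by unfold_locales (auto simp: algebra_simps)

global_interpretation frac_mod: Modules.module "\<lambda>(r :: 'z::idom) (x :: 'z fract). to_fract r * x"
  by unfold_locales
    (simp_all only: to_fract_add to_fract_mult to_fract_1 distrib_left distrib_right mult.assoc mult_1_left)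

definition fractional_ideal :: "'z::idom fract set \<Rightarrow> bool" where
  "fractional_ideal I \<longleftrightarrow> (\<exists>S. finite S \<and> I = frac_mod.span S)"

definition ideal_prod :: "'z::idom fract set \<Rightarrow> 'z fract set \<Rightarrow> 'z fract set" where
  "ideal_prod I J = frac_mod.span {x * y | x y. x \<in> I \<and> y \<in> J}"

definition invertible_ideal :: "'z::idom fract set \<Rightarrow> bool" where
  "invertible_ideal I \<longleftrightarrow>
     fractional_ideal I \<and> (\<exists>J. fractional_ideal J \<and> ideal_prod I J = range to_fract)"

definition pruefer_domain :: "'z::idom itself \<Rightarrow> bool" where
  "pruefer_domain _ \<longleftrightarrow>
     (\<forall>S :: 'z set. finite S \<longrightarrow> int_ideal.span S \<noteq> {0} \<longrightarrow>
        invertible_ideal (to_fract ` int_ideal.span S))"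


section \<open>Pseudo-matrices\<close>

text \<open>All indices start at 0.\<close>

datatype 'k pmat = PMat (row_ideals: "'k set list") (col_ideals: "'k set list") (entries: "'k mat")

definition pseudo_matrix :: "'z::idom fract pmat \<Rightarrow> bool" where
  "pseudo_matrix M \<longleftrightarrow>
     entries M \<in> carrier_mat (length (row_ideals M)) (length (col_ideals M)) \<and>
     (\<forall>h \<in> set (row_ideals M). invertible_ideal h) \<and>
     (\<forall>e \<in> set (col_ideals M). invertible_ideal e) \<and>
     (\<forall>i < length (row_ideals M). \<forall>j < length (col_ideals M).
        (\<lambda>x. entries M $$ (i, j) * x) ` (col_ideals M ! j) \<subseteq> row_ideals M ! i)"

text \<open>Only meaningful if \<open>col_ideals B = row_ideals A\<close>.\<close>

definition pmat_prod :: "'z::idom fract pmat \<Rightarrow> 'z fract pmat \<Rightarrow> 'z fract pmat" where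
  "pmat_prod B A = PMat (row_ideals B) (col_ideals A) (entries B * entries A)"

definition invertible_pmat :: "'z::idom fract pmat \<Rightarrow> bool" where
  "invertible_pmat M \<longleftrightarrow>
     pseudo_matrix M \<and> length (row_ideals M) = length (col_ideals M) \<and>
     (\<exists>N. inverts_mat (entries M) N \<and> inverts_mat N (entries M) \<and>
        pseudo_matrix (PMat (col_ideals M) (row_ideals M) N))"

text \<open>Left multiplication by \<open>perm_mat n \<sigma>\<close> yields the matrix whose row \<open>i\<close> is the former
  row \<open>\<sigma> i\<close>; \<open>perm_pmat\<close> permutes the row ideals in the same way.\<close>

definition perm_mat :: "nat \<Rightarrow> (nat \<Rightarrow> nat) \<Rightarrow> 'z::idom mat" where
  "perm_mat n \<sigma> = mat n n (\<lambda>(i, j). if j = \<sigma> i then 1 else 0)"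

definition perm_pmat :: "'z::idom fract set list \<Rightarrow> (nat \<Rightarrow> nat) \<Rightarrow> 'z fract pmat" where
  "perm_pmat hs \<sigma> =
     PMat (map (\<lambda>i. hs ! \<sigma> i) [0..<length hs]) hs (map_mat to_fract (perm_mat (length hs) \<sigma>))"

definition reduced_hermite_form :: "'a::comm_ring_1 mat \<Rightarrow> bool" where
  "reduced_hermite_form M \<longleftrightarrow>
     (\<exists>r p q T G. T \<in> carrier_mat r r \<and> G \<in> carrier_mat p r \<and>
        (\<forall>i < r. \<forall>j < r. i < j \<longrightarrow> T $$ (i, j) = 0) \<and> det T \<noteq> 0 \<and>
        M = four_block_mat T (0\<^sub>m r q) G (0\<^sub>m p q))"

definition hermite_reduction :: "'z::idom fract pmat \<Rightarrow> 'z mat \<Rightarrow> 'z fract pmat \<Rightarrow> bool" where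
  "hermite_reduction A L C \<longleftrightarrow>
     row_ideals C = col_ideals A \<and> invertible_pmat C \<and>
     (\<exists>\<sigma>. \<sigma> permutes {..<length (row_ideals A)} \<and> L = perm_mat (length (row_ideals A)) \<sigma> \<and>
        reduced_hermite_form
          (entries (pmat_prod (pmat_prod (perm_pmat (row_ideals A) \<sigma>) A) C)))"


section \<open>Computability relative to the algorithms given for the domain\<close>

text \<open>
  An algorithm for inverting finitely generated ideals: for generators \<open>as\<close>, not all zero, of an
  ideal of \<open>Z\<close> it returns generators of the inverse ideal, as fractions \<open>(numerator, denominator)\<close>.
  Constructively, the equation \<open>I * J = Z\<close> comes with a witness \<open>1 = \<Sum>i k. c i k * a i * z k\<close>
  where the \<open>a i\<close> generate \<open>I\<close>, the \<open>z k\<close> generate \<open>J\<close> and the \<open>c i k\<close> are in \<open>Z\<close>.  Replacing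
  the \<open>z k\<close> by the elements \<open>x i = \<Sum>k. c i k * z k\<close>, which again generate \<open>J\<close>, we may assume
  that the witness is \<open>1 = \<Sum>i. a i * x i\<close>.
\<close>

definition frac_val :: "'z::idom \<times> 'z \<Rightarrow> 'z fract" where
  "frac_val x = Fract (fst x) (snd x)"

definition inverts_fg_ideals :: "('z::idom list \<Rightarrow> ('z \<times> 'z) list) \<Rightarrow> bool" where
  "inverts_fg_ideals idinv \<longleftrightarrow>
     (\<forall>as. (\<exists>a \<in> set as. a \<noteq> 0) \<longrightarrow>
        length (idinv as) = length as \<and>
        (\<forall>x \<in> set (idinv as). snd x \<noteq> 0) \<and>
        ideal_prod (frac_mod.span (to_fract ` set as)) (frac_mod.span (frac_val ` set (idinv as)))
          = range to_fract \<and>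
        (\<Sum>i < length as. to_fract (as ! i) * frac_val (idinv as ! i)) = 1)"

text \<open>
  Data are finite binary trees whose leaves are \<open>DNil\<close> or elements of the domain.  Programs are
  those of a WHILE language over such trees (Turing complete already without the elements of the
  domain).  The elements of the domain can only be accessed through the ring operations, the
  divisibility test and the inversion of finitely generated ideals.  \<open>DNil\<close> serves as the truth
  value false and as the empty list, any other tree as true.  A program that is applied to data of
  the wrong shape gets stuck.
\<close>

datatype 'z datum = DNil | DElem 'z | DPair "'z datum" "'z datum"

fun list_datum :: "'z datum list \<Rightarrow> 'z datum" where
  "list_datum [] = DNil"
| "list_datum (d # ds) = DPair d (list_datum ds)"

definition frac_datum :: "'z \<times> 'z \<Rightarrow> 'z datum" where
  "frac_datum x = DPair (DElem (fst x)) (DElem (snd x))"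

datatype prog =
  PId | PNil | PFst | PSnd | PPair prog prog | PSeq prog prog | PIf prog prog prog
| PWhile prog prog
| PZero | POne | PAdd | PNeg | PMult | PDvd | PInv

inductive runs :: "('z::idom list \<Rightarrow> ('z \<times> 'z) list) \<Rightarrow> prog \<Rightarrow> 'z datum \<Rightarrow> 'z datum \<Rightarrow> bool"
  for idinv where
  "runs idinv PId x x"
| "runs idinv PNil x DNil"
| "runs idinv PFst (DPair x y) x"
| "runs idinv PSnd (DPair x y) y"
| "runs idinv p x y \<Longrightarrow> runs idinv q x z \<Longrightarrow> runs idinv (PPair p q) x (DPair y z)"
| "runs idinv p x y \<Longrightarrow> runs idinv q y z \<Longrightarrow> runs idinv (PSeq p q) x z"
| "runs idinv b x t \<Longrightarrow> t \<noteq> DNil \<Longrightarrow> runs idinv p x y \<Longrightarrow> runs idinv (PIf b p q) x y"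
| "runs idinv b x DNil \<Longrightarrow> runs idinv q x y \<Longrightarrow> runs idinv (PIf b p q) x y"
| "runs idinv b x DNil \<Longrightarrow> runs idinv (PWhile b p) x x"
| "runs idinv b x t \<Longrightarrow> t \<noteq> DNil \<Longrightarrow> runs idinv p x y \<Longrightarrow> runs idinv (PWhile b p) y z \<Longrightarrow>
     runs idinv (PWhile b p) x z"
| "runs idinv PZero x (DElem 0)"
| "runs idinv POne x (DElem 1)"
| "runs idinv PAdd (DPair (DElem a) (DElem b)) (DElem (a + b))"
| "runs idinv PNeg (DElem a) (DElem (- a))"
| "runs idinv PMult (DPair (DElem a) (DElem b)) (DElem (a * b))"
| "runs idinv PDvd (DPair (DElem a) (DElem b)) (if a dvd b then DPair DNil DNil else DNil)"
| "\<exists>a \<in> set as. a \<noteq> 0 \<Longrightarrow>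
     runs idinv PInv (list_datum (map DElem as)) (list_datum (map frac_datum (idinv as)))"

text \<open>Representation of mathematical objects by data: elements of \<open>K\<close> are given by arbitrary
  fractions, fractional ideals by finite lists of generators, matrices by the list of their rows.\<close>

definition codes_elem :: "'z datum \<Rightarrow> 'z \<Rightarrow> bool" where
  "codes_elem d a \<longleftrightarrow> d = DElem a"

definition codes_frac :: "'z::idom datum \<Rightarrow> 'z fract \<Rightarrow> bool" where
  "codes_frac d x \<longleftrightarrow> (\<exists>a b. b \<noteq> 0 \<and> d = frac_datum (a, b) \<and> x = Fract a b)"

definition codes_list :: "('z datum \<Rightarrow> 'a \<Rightarrow> bool) \<Rightarrow> 'z datum \<Rightarrow> 'a list \<Rightarrow> bool" where
  "codes_list R d xs \<longleftrightarrow> (\<exists>ds. d = list_datum ds \<and> list_all2 R ds xs)"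

definition codes_mat :: "('z datum \<Rightarrow> 'a \<Rightarrow> bool) \<Rightarrow> 'z datum \<Rightarrow> 'a mat \<Rightarrow> bool" where
  "codes_mat R d M \<longleftrightarrow> codes_list (codes_list R) d (mat_to_list M)"

definition codes_ideal :: "'z::idom datum \<Rightarrow> 'z fract set \<Rightarrow> bool" where
  "codes_ideal d I \<longleftrightarrow> (\<exists>xs. codes_list codes_frac d xs \<and> I = frac_mod.span (set xs))"

definition codes_pmat :: "'z::idom datum \<Rightarrow> 'z fract pmat \<Rightarrow> bool" where
  "codes_pmat d M \<longleftrightarrow>
     (\<exists>dh de dM. d = DPair dh (DPair de dM) \<and> codes_list codes_ideal dh (row_ideals M) \<and>
        codes_list codes_ideal de (col_ideals M) \<and> codes_mat codes_frac dM (entries M))"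


section \<open>Sanity checks\<close>

lemma list_datum_inject: "list_datum xs = list_datum ys \<Longrightarrow> xs = ys"
  by (induction xs arbitrary: ys; case_tac ys) auto

inductive_cases runs_elims:
  "runs idinv PId x z" "runs idinv PNil x z" "runs idinv PFst x z" "runs idinv PSnd x z"
  "runs idinv PZero x z" "runs idinv POne x z" "runs idinv PAdd x z" "runs idinv PNeg x z"
  "runs idinv PMult x z" "runs idinv PDvd x z"
inductive_cases runs_PPairE: "runs idinv (PPair p q) x z"
inductive_cases runs_PSeqE: "runs idinv (PSeq p q) x z"
inductive_cases runs_PIfE: "runs idinv (PIf b p q) x z"
inductive_cases runs_PWhileE: "runs idinv (PWhile b p) x z"
inductive_cases runs_PInvE: "runs idinv PInv x z"

lemma runs_deterministic: "runs idinv p x y \<Longrightarrow> runs idinv p x z \<Longrightarrow> y = z"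
proof (induction arbitrary: z rule: runs.induct)
  case (5 p x y q z')
  from 5(5) show ?case by (rule runs_PPairE) (simp add: 5(3)[of _] 5(4)[of _])
next
  case (6 p x y q z')
  from 6(5) show ?case
  proof (rule runs_PSeqE)
    fix w assume "runs idinv p x w" "runs idinv q w z"
    with 6(3)[of w] 6(4)[of z] show ?thesis by simp
  qed
next
  case (7 b x t p y q)
  from 7(6) show ?case
  proof (rule runs_PIfE)
    assume "runs idinv p x z" then show ?thesis by (rule 7(5))
  next
    assume "runs idinv b x DNil" with 7(4)[of DNil] 7(2) show ?thesis by simp
  qed
next
  case (8 b x q y p)
  from 8(5) show ?case
  proof (rule runs_PIfE)
    assume "runs idinv q x z" then show ?thesis by (rule 8(4))
  next
    fix t assume "runs idinv b x t" "t \<noteq> DNil" with 8(3)[of t] show ?thesis by simp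
  qed
next
  case (9 b x p)
  from 9(3) show ?case
  proof (rule runs_PWhileE)
    assume "z = x" then show ?thesis by simp
  next
    fix t assume "runs idinv b x t" "t \<noteq> DNil" with 9(2)[of t] show ?thesis by simp
  qed
next
  case (10 b x t p y z')
  from 10(8) show ?case
  proof (rule runs_PWhileE)
    assume "runs idinv b x DNil" with 10(5)[of DNil] 10(2) show ?thesis by simp
  next
    fix w assume "runs idinv p x w" "runs idinv (PWhile b p) w z"
    with 10(6)[of w] 10(7)[of z] show ?thesis by simp
  qed
next
  case (17 as)
  have inj: "inj (DElem :: 'a \<Rightarrow> 'a datum)" by (simp add: inj_def)
  from 17(2) show ?case
  proof (rule runs_PInvE)
    fix bs
    assume "list_datum (map DElem as) = list_datum (map DElem bs)"
      and z: "z = list_datum (map frac_datum (idinv bs))"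
    then have "as = bs" using list_datum_inject inj_map_eq_map[OF inj] by blast
    with z show ?thesis by simp
  qed
qed (erule runs_elims; simp)+

lemma codes_frac_exists: "\<exists>d. codes_frac d x"
  by (cases x) (auto simp: codes_frac_def)

lemma codes_list_exists: "(\<And>x. x \<in> set xs \<Longrightarrow> \<exists>d. R d x) \<Longrightarrow> \<exists>d. codes_list R d xs"
proof (induction xs)
  case Nil
  then show ?case by (auto simp: codes_list_def)
next
  case (Cons x xs)
  then obtain d where "R d x" by auto
  moreover obtain ds where "list_all2 R ds xs"
    using Cons by (auto simp: codes_list_def)
  ultimately have "list_all2 R (d # ds) (x # xs)" by simp
  then show ?case unfolding codes_list_def by blast
qed

lemma codes_pmat_exists:
  assumes "pseudo_matrix A"
  shows "\<exists>d. codes_pmat d A"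
proof -
  have ideal: "\<exists>d. codes_ideal d I" if I: "invertible_ideal I" for I :: "'a fract set"
  proof -
    obtain S where S: "finite S" "I = frac_mod.span S"
      using I by (auto simp: invertible_ideal_def fractional_ideal_def)
    obtain xs where "set xs = S" using S(1) finite_list by blast
    moreover have "\<exists>d. codes_list codes_frac d xs"
      by (rule codes_list_exists) (rule codes_frac_exists)
    ultimately show ?thesis using S(2) unfolding codes_ideal_def by blast
  qed
  obtain dh where "codes_list codes_ideal dh (row_ideals A)"
    using codes_list_exists[of "row_ideals A" codes_ideal] ideal assms
    by (auto simp: pseudo_matrix_def)
  moreover obtain de where "codes_list codes_ideal de (col_ideals A)"
    using codes_list_exists[of "col_ideals A" codes_ideal] ideal assms
    by (auto simp: pseudo_matrix_def)
  moreover obtain dM where "codes_mat codes_frac dM (entries A)"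
    unfolding codes_mat_def by (metis codes_list_exists codes_frac_exists)
  ultimately show ?thesis unfolding codes_pmat_def by blast
qed

lemma perm_pmat_pseudo_matrix:
  assumes "\<forall>h \<in> set hs. invertible_ideal h" and \<sigma>: "\<sigma> permutes {..<length hs}"
  shows "pseudo_matrix (perm_pmat hs \<sigma>)"
proof -
  have *: "\<sigma> i < length hs" if "i < length hs" for i
    using permutes_in_image[OF \<sigma>, of i] that by simp
  have zero: "0 \<in> h" if "h \<in> set hs" for h
    using assms(1) that frac_mod.span_zero
    by (auto simp: invertible_ideal_def fractional_ideal_def)
  show ?thesis
    using assms(1) * zero
    by (auto simp: pseudo_matrix_def perm_pmat_def perm_mat_def)
qed

end

(*
  A row (a, b) acting on two columns with ideals e, f, where b is nonzero, is cleared as follows.  The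
  ideal c = a e + b f is invertible, so a x + b y = 1 for some x in e c^{-1} and y in f c^{-1}.  The
  matrix [[x, -b], [y, a]] has determinant 1 and, together with its inverse [[a, b], [-y, x]], maps
  between e, f and c, e f c^{-1}; it turns the row into (1, 0).  Sweeping each row of the matrix in turn
  over the columns that do not carry a pivot yet leaves at most one of these columns with a nonzero
  entry in that row, and this column becomes the pivot column; rows without a pivot are permuted to the
  bottom.  Every column is stored with the dual row of the inverse matrix, so that invertibility is
  visible in the state.

  The functions on fractions, pairs and lists that programs can compute are closed under composition
  and folds over lists; this yields a program for the whole reduction.
*)
theory Submission
  imports Defs
begin

text \<open>The triangular shape comes from the order of work. Columns without a pivot vanish on
  every row already treated, and combining such columns preserves this, while a pivot column is
  never changed again. Hence a later pivot column is zero in all earlier pivot rows, and no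
  back-substitution is required. The coefficients x and y come from the inversion algorithm itself:
  c is generated by the elements a g and b h, where g and h run through generators of e and f, and
  the algorithm returns a witness for 1 in c c^{-1}. Collecting the terms with factor a and those
  with factor b turns this witness into a x + b y = 1. Invertibility of the new ideals needs no
  bookkeeping beyond one nonzero generator, because every nonzero finitely generated fractional
  ideal is inverted after clearing denominators. Every loop runs over a list that is already at
  hand, and the size of a matrix is only ever given as the length of a list, so folds suffice and
  termination is never an issue.\<close>

text \<open>As simp rules these reassociate products to the left and hence loop with \<open>ac_simps\<close>.\<close>

declare int_ideal.scale_scale [simp del] frac_mod.scale_scale [simp del]

section \<open>Fractions as data\<close>

text \<open>The algorithm works on representatives and not on \<open>fract\<close>, since the inverse of an ideal may depend
  on the chosen numerators and denominators.\<close>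

typedef (overloaded) 'z quot = "{x :: 'z::idom \<times> 'z. snd x \<noteq> 0}"
  morphisms rep_quot mk_quot
  by (rule exI[of _ "(0, 1)"]) simp

definition num :: "'z::idom quot \<Rightarrow> 'z" where "num q = fst (rep_quot q)"
definition den :: "'z::idom quot \<Rightarrow> 'z" where "den q = snd (rep_quot q)"
definition val :: "'z::idom quot \<Rightarrow> 'z fract" where "val q = Fract (num q) (den q)"

definition q_of :: "'z::idom \<Rightarrow> 'z quot" where "q_of a = mk_quot (a, 1)"
definition q_add :: "'z::idom quot \<Rightarrow> 'z quot \<Rightarrow> 'z quot" where
  "q_add p q = mk_quot (num p * den q + num q * den p, den p * den q)"
definition q_mult :: "'z::idom quot \<Rightarrow> 'z quot \<Rightarrow> 'z quot" where
  "q_mult p q = mk_quot (num p * num q, den p * den q)"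
definition q_neg :: "'z::idom quot \<Rightarrow> 'z quot" where "q_neg p = mk_quot (- num p, den p)"

lemma den_nonzero [simp]: "den q \<noteq> 0"
  using rep_quot[of q] by (simp add: den_def)

lemma rep_quot_ops:
  "rep_quot (q_of a) = (a, 1)"
  "rep_quot (q_add p q) = (num p * den q + num q * den p, den p * den q)"
  "rep_quot (q_mult p q) = (num p * num q, den p * den q)"
  "rep_quot (q_neg p) = (- num p, den p)"
  by (simp_all add: q_of_def q_add_def q_mult_def q_neg_def mk_quot_inverse)

lemma val_ops [simp]:
  "val (q_of a) = to_fract a"
  "val (q_add p q) = val p + val q"
  "val (q_mult p q) = val p * val q"
  "val (q_neg p) = - val p"
  by (simp_all add: val_def num_def[of "q_of _"] num_def[of "q_add _ _"] num_def[of "q_mult _ _"]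
      num_def[of "q_neg _"] den_def[of "q_of _"] den_def[of "q_add _ _"] den_def[of "q_mult _ _"]
      den_def[of "q_neg _"] rep_quot_ops to_fract_def)

lemma val_eq_0_iff: "val q = 0 \<longleftrightarrow> num q = 0"
  by (simp add: val_def Zero_fract_def eq_fract)

lemma val_mk_quot: "b \<noteq> 0 \<Longrightarrow> val (mk_quot (a, b)) = Fract a b"
  by (simp add: val_def num_def den_def mk_quot_inverse)

section \<open>Computable functions\<close>

fun enc_bool :: "bool \<Rightarrow> 'z datum" where
  "enc_bool True = DPair DNil DNil" | "enc_bool False = DNil"

fun enc_pair :: "('a \<Rightarrow> 'z datum) \<Rightarrow> ('b \<Rightarrow> 'z datum) \<Rightarrow> 'a \<times> 'b \<Rightarrow> 'z datum" where
  "enc_pair E F (x, y) = DPair (E x) (F y)"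

definition enc_list :: "('a \<Rightarrow> 'z datum) \<Rightarrow> 'a list \<Rightarrow> 'z datum" where
  "enc_list E xs = list_datum (map E xs)"

definition enc_quot :: "'z::idom quot \<Rightarrow> 'z datum" where
  "enc_quot q = frac_datum (rep_quot q)"

lemma enc_list_simps [simp]:
  "enc_list E [] = DNil" "enc_list E (x # xs) = DPair (E x) (enc_list E xs)"
  by (simp_all add: enc_list_def)

lemma enc_quot_eq: "enc_quot q = DPair (DElem (num q)) (DElem (den q))"
  by (simp add: enc_quot_def frac_datum_def num_def den_def)

text \<open>\<open>E\<close> encodes the environment of free variables and each subterm is a
  function of that environment, which makes the closure rules syntax-directed. Functions are total,
  so no rule has a side condition on its argument.\<close>

definition computes ::
  "('z::idom list \<Rightarrow> ('z \<times> 'z) list) \<Rightarrow> ('a \<Rightarrow> 'z datum) \<Rightarrow> ('b \<Rightarrow> 'z datum) \<Rightarrow> ('a \<Rightarrow> 'b) \<Rightarrow> bool" where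
  "computes idinv E F f \<longleftrightarrow> (\<exists>p. \<forall>x. runs idinv p (E x) (F (f x)))"

named_theorems computes_intros

lemma computesI: "(\<And>x. runs idinv p (E x) (F (f x))) \<Longrightarrow> computes idinv E F f"
  by (auto simp: computes_def)

text \<open>This rule stays out of \<open>computes_intros\<close>, since its conclusion unifies with
  every goal.\<close>

lemma computes_comp:
  assumes "computes idinv E F f" "computes idinv F G g"
  shows "computes idinv E G (\<lambda>x. g (f x))"
  using assms unfolding computes_def by (metis runs.intros(6))

lemma computes_id [computes_intros]: "computes idinv E E (\<lambda>x. x)"
  by (rule computesI[of _ PId]) (rule runs.intros)

lemma computes_Pair [computes_intros]:
  assumes "computes idinv E F f" "computes idinv E G g"
  shows "computes idinv E (enc_pair F G) (\<lambda>x. (f x, g x))"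
  using assms unfolding computes_def by (metis enc_pair.simps runs.intros(5))

lemma computes_fst [computes_intros]:
  assumes "computes idinv E (enc_pair F G) f"
  shows "computes idinv E F (\<lambda>x. fst (f x))"
proof (rule computes_comp[OF assms], rule computesI[of _ PFst])
  show "runs idinv PFst (enc_pair F G x) (F (fst x))" for x
    by (cases x) (simp add: runs.intros)
qed

lemma computes_snd [computes_intros]:
  assumes "computes idinv E (enc_pair F G) f"
  shows "computes idinv E G (\<lambda>x. snd (f x))"
proof (rule computes_comp[OF assms], rule computesI[of _ PSnd])
  show "runs idinv PSnd (enc_pair F G x) (G (snd x))" for x
    by (cases x) (simp add: runs.intros)
qed

text \<open>Binding a variable extends the environment to a pair: \<open>fst z\<close> is the old
  environment and \<open>snd z\<close> the new variable. The rules for case distinctions and folds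
  bind in the same way.\<close>

lemma computes_let [computes_intros]:
  assumes "computes idinv E A f" "computes idinv (enc_pair E A) F (\<lambda>z. g (fst z) (snd z))"
  shows "computes idinv E F (\<lambda>x. Let (f x) (g x))"
  using computes_comp[OF computes_Pair[OF computes_id assms(1)] assms(2)] by simp

lemma computes_if [computes_intros]:
  assumes "computes idinv E enc_bool b" "computes idinv E F f" "computes idinv E F g"
  shows "computes idinv E F (\<lambda>x. if b x then f x else g x)"
proof -
  from assms obtain pb pf pg where p: "\<And>x. runs idinv pb (E x) (enc_bool (b x))"
    "\<And>x. runs idinv pf (E x) (F (f x))" "\<And>x. runs idinv pg (E x) (F (g x))"
    unfolding computes_def by metis
  show ?thesis
  proof (rule computesI[of _ "PIf pb pf pg"])
    fix x
    show "runs idinv (PIf pb pf pg) (E x) (F (if b x then f x else g x))"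
      using p(1)[of x] p(2,3)[of x] by (cases "b x") (auto intro: runs.intros(7,8))
  qed
qed

section \<open>Programs on lists: case distinction and folds\<close>

lemma computes_Nil [computes_intros]: "computes idinv E (enc_list F) (\<lambda>x. [])"
  by (rule computesI[of _ PNil]) (simp add: runs.intros)

lemma computes_Cons [computes_intros]:
  assumes "computes idinv E F f" "computes idinv E (enc_list F) g"
  shows "computes idinv E (enc_list F) (\<lambda>x. f x # g x)"
  using assms unfolding computes_def by (metis enc_list_simps(2) runs.intros(5))

text \<open>The code of a list is \<open>DNil\<close> exactly for the empty list, so the list itself
  serves as the test.\<close>

lemma computes_case_list [computes_intros]:
  assumes "computes idinv E (enc_list A) xs" "computes idinv E F f"
    "computes idinv (enc_pair E (enc_pair A (enc_list A))) F (\<lambda>z. g (fst z) (fst (snd z)) (snd (snd z)))"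
  shows "computes idinv E F (\<lambda>x. case_list (f x) (g x) (xs x))"
proof -
  from assms obtain pl pf pg where p: "\<And>x. runs idinv pl (E x) (enc_list A (xs x))"
    "\<And>x. runs idinv pf (E x) (F (f x))"
    "\<And>x y ys. runs idinv pg (DPair (E x) (DPair (A y) (enc_list A ys))) (F (g x y ys))"
    unfolding computes_def by (metis enc_pair.simps fst_conv snd_conv)
  show ?thesis
  proof (rule computesI[of _ "PIf pl (PSeq (PPair PId pl) pg) pf"])
    fix x
    show "runs idinv (PIf pl (PSeq (PPair PId pl) pg) pf) (E x) (F (case_list (f x) (g x) (xs x)))"
    proof (cases "xs x")
      case Nil
      then show ?thesis using p(1)[of x] p(2)[of x] by (auto intro: runs.intros(8))
    next
      case (Cons y ys)
      have "runs idinv (PSeq (PPair PId pl) pg) (E x) (F (g x y ys))"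
        using p(1)[of x] p(3)[of x y ys] Cons by (auto intro!: runs.intros(6) runs.intros(5) runs.intros(1))
      then show ?thesis using p(1)[of x] Cons by (auto intro: runs.intros(7))
    qed
  qed
qed

text \<open>This is the only use of \<open>PWhile\<close>. The loop state is (environment, (unread
  list, accumulator)), and the unread list is the loop condition. The environment travels along
  because the step function may depend on it.\<close>

lemma computes_fold [computes_intros]:
  assumes "computes idinv E (enc_list A) xs" "computes idinv E S s"
    "computes idinv (enc_pair E (enc_pair A S)) S (\<lambda>z. f (fst z) (fst (snd z)) (snd (snd z)))"
  shows "computes idinv E S (\<lambda>x. fold (f x) (xs x) (s x))"
proof -
  from assms obtain pl ps pf where p: "\<And>x. runs idinv pl (E x) (enc_list A (xs x))"
    "\<And>x. runs idinv ps (E x) (S (s x))"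
    "\<And>x y t. runs idinv pf (DPair (E x) (DPair (A y) (S t))) (S (f x y t))"
    unfolding computes_def by (metis enc_pair.simps fst_conv snd_conv)
  \<comment> \<open>The input given to \<open>pf\<close> regroups the state into (environment,
    (head, accumulator)).\<close>
  define body where "body = PPair PFst (PPair (PSeq PSnd (PSeq PFst PSnd))
    (PSeq (PPair PFst (PPair (PSeq PSnd (PSeq PFst PFst)) (PSeq PSnd PSnd))) pf))"
  have body: "runs idinv body (DPair (E x) (DPair (enc_list A (y # ys)) (S t)))
    (DPair (E x) (DPair (enc_list A ys) (S (f x y t))))" for x y ys t
    unfolding body_def enc_list_simps by (rule runs.intros(3-6) p(3))+
  have loop: "runs idinv (PWhile (PSeq PSnd PFst) body) (DPair (E x) (DPair (enc_list A ys) (S t)))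
    (DPair (E x) (DPair DNil (S (fold (f x) ys t))))" for x ys t
  proof (induction ys arbitrary: t)
    case Nil
    show ?case by (auto intro!: runs.intros(9) runs.intros(3,4,6))
  next
    case (Cons y ys)
    have "runs idinv (PSeq PSnd PFst) (DPair (E x) (DPair (enc_list A (y # ys)) (S t))) (enc_list A (y # ys))"
      by (rule runs.intros(3,4,6))+
    moreover have "enc_list A (y # ys) \<noteq> DNil" by simp
    ultimately show ?case using runs.intros(10) body Cons[of "f x y t"] by (metis fold_simps(2))
  qed
  show ?thesis
    by (rule computesI[of _ "PSeq (PPair PId (PPair pl ps)) (PSeq (PWhile (PSeq PSnd PFst) body) (PSeq PSnd PSnd))"])
      (rule runs.intros(1,4,5,6) p loop)+
qed

lemma computes_rev [computes_intros]:
  assumes "computes idinv E (enc_list A) f"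
  shows "computes idinv E (enc_list A) (\<lambda>x. rev (f x))"
  unfolding rev_conv_fold by (rule assms computes_intros)+

lemma computes_foldr [computes_intros]:
  assumes "computes idinv E (enc_list A) xs" "computes idinv E S s"
    "computes idinv (enc_pair E (enc_pair A S)) S (\<lambda>z. f (fst z) (fst (snd z)) (snd (snd z)))"
  shows "computes idinv E S (\<lambda>x. foldr (f x) (xs x) (s x))"
  unfolding foldr_conv_fold by (rule assms computes_intros)+

lemma append_conv_foldr: "xs @ ys = foldr (#) xs ys"
  by (induction xs) auto

lemma computes_append [computes_intros]:
  assumes "computes idinv E (enc_list A) f" "computes idinv E (enc_list A) g"
  shows "computes idinv E (enc_list A) (\<lambda>x. f x @ g x)"
  unfolding append_conv_foldr by (rule assms computes_intros)+

lemma computes_concat [computes_intros]: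
  assumes "computes idinv E (enc_list (enc_list A)) f"
  shows "computes idinv E (enc_list A) (\<lambda>x. concat (f x))"
  unfolding concat_conv_foldr by (rule assms computes_intros)+

lemma map_conv_foldr: "map h ys = foldr (\<lambda>y. (#) (h y)) ys []"
  by (induction ys) auto

lemma computes_map [computes_intros]:
  assumes "computes idinv E (enc_list A) xs"
    "computes idinv (enc_pair E A) B (\<lambda>z. f (fst z) (snd z))"
  shows "computes idinv E (enc_list B) (\<lambda>x. map (f x) (xs x))"
proof -
  \<comment> \<open>The fold adds its accumulator to the environment, but the mapped function
    expects only the list element there; precomposition with a projection adapts its
    program.\<close>
  have aux: "computes idinv (enc_pair E (enc_pair A (enc_list B))) B (\<lambda>z. f (fst z) (fst (snd z)))"
    by (rule computes_comp[OF _ assms(2), of "enc_pair E (enc_pair A (enc_list B))"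
          "\<lambda>z. (fst z, fst (snd z))", simplified]) (rule computes_intros)+
  show ?thesis unfolding map_conv_foldr by (rule aux assms computes_intros)+
qed

text \<open>A fold reads a single list, so the second one travels in the state next to the reversed
  results. Once it is exhausted the state no longer changes, which agrees with the truncation in
  \<open>zip\<close>.\<close>

definition zip_step :: "('a \<Rightarrow> 'b \<Rightarrow> 'c) \<Rightarrow> 'a \<Rightarrow> 'c list \<times> 'b list \<Rightarrow> 'c list \<times> 'b list" where
  "zip_step g x s = (case snd s of [] \<Rightarrow> s | y # r \<Rightarrow> (g x y # fst s, r))"

lemma map2_conv_fold: "map2 g xs ys = rev (fst (fold (zip_step g) xs ([], ys)))"
proof -
  have "fst (fold (zip_step g) xs (acc, ys)) = rev (map2 g xs ys) @ acc" for acc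
  proof (induction xs arbitrary: ys acc)
    case (Cons x xs)
    have "fst (fold (zip_step g) us (acc, [])) = acc" for us
      by (induction us) (auto simp: zip_step_def)
    then show ?case using Cons by (cases ys) (auto simp: zip_step_def)
  qed simp
  then show ?thesis by simp
qed

lemma computes_map2 [computes_intros]:
  assumes "computes idinv E (enc_list A) xs" "computes idinv E (enc_list B) ys"
    "computes idinv (enc_pair E (enc_pair A B)) F (\<lambda>z. f (fst z) (fst (snd z)) (snd (snd z)))"
  shows "computes idinv E (enc_list F) (\<lambda>x. map2 (f x) (xs x) (ys x))"
proof -
  have f: "computes idinv (enc_pair (enc_pair E (enc_pair A (enc_pair (enc_list F) (enc_list B))))
      (enc_pair B (enc_list B))) F (\<lambda>z. f (fst (fst z)) (fst (snd (fst z))) (fst (snd z)))"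
    by (rule computes_comp[OF _ assms(3), where E="enc_pair (enc_pair E (enc_pair A (enc_pair (enc_list F) (enc_list B))))
      (enc_pair B (enc_list B))" and f="\<lambda>z. (fst (fst z), fst (snd (fst z)), fst (snd z))", simplified]) (rule computes_intros)+
  show ?thesis unfolding map2_conv_fold zip_step_def by (rule f assms computes_intros)+
qed

section \<open>Arithmetic in the ring and on fractions\<close>

lemma computes_Elem:
  assumes "computes idinv E enc_quot f"
  shows computes_num [computes_intros]: "computes idinv E DElem (\<lambda>x. num (f x))"
    and computes_den [computes_intros]: "computes idinv E DElem (\<lambda>x. den (f x))"
  using computes_comp[OF assms computesI[of _ PFst _ DElem num]]
    computes_comp[OF assms computesI[of _ PSnd _ DElem den]]
  by (simp_all add: enc_quot_eq runs.intros)

lemma computes_const [computes_intros]: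
  "computes idinv E DElem (\<lambda>x. 0)" "computes idinv E DElem (\<lambda>x. 1)"
  by (rule computesI[of _ PZero], rule runs.intros) (rule computesI[of _ POne], rule runs.intros)

lemma computes_ring_op [computes_intros]:
  assumes "computes idinv E DElem f"
  shows "computes idinv E DElem (\<lambda>x. - f x)"
    and "computes idinv E DElem g \<Longrightarrow> computes idinv E DElem (\<lambda>x. f x + g x)"
    and "computes idinv E DElem g \<Longrightarrow> computes idinv E DElem (\<lambda>x. f x * g x)"
proof -
  show "computes idinv E DElem (\<lambda>x. - f x)"
    by (rule computes_comp[OF assms, of DElem], rule computesI, rule runs.intros(14))
  assume g: "computes idinv E DElem g"
  have "computes idinv E DElem (\<lambda>x. fst (f x, g x) + snd (f x, g x))"
    by (rule computes_comp[OF computes_Pair[OF assms g], of DElem "\<lambda>z. fst z + snd z"],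
        rule computesI[of _ PAdd]) (case_tac x, simp add: runs.intros(13))
  then show "computes idinv E DElem (\<lambda>x. f x + g x)" by simp
  have "computes idinv E DElem (\<lambda>x. fst (f x, g x) * snd (f x, g x))"
    by (rule computes_comp[OF computes_Pair[OF assms g], of DElem "\<lambda>z. fst z * snd z"],
        rule computesI[of _ PMult]) (case_tac x, simp add: runs.intros(15))
  then show "computes idinv E DElem (\<lambda>x. f x * g x)" by simp
qed

text \<open>Programs have no equality test, but divisibility supplies the test against zero:
  \<open>0 dvd a\<close> holds only for \<open>a = 0\<close>.\<close>

lemma computes_eq_0 [computes_intros]:
  assumes "computes idinv E DElem f"
  shows "computes idinv E enc_bool (\<lambda>x. f x = 0)"
proof (rule computes_comp[OF assms, of enc_bool], rule computesI)
  show "runs idinv (PSeq (PPair PZero PId) PDvd) (DElem a) (enc_bool (a = 0))" for a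
  proof (rule runs.intros(6))
    show "runs idinv (PPair PZero PId) (DElem a) (DPair (DElem 0) (DElem a))"
      by (rule runs.intros(1,5,11))+
    show "runs idinv PDvd (DPair (DElem 0) (DElem a)) (enc_bool (a = 0))"
      using runs.intros(16)[of idinv 0 a] by (cases "a = 0") simp_all
  qed
qed

lemma computes_quot:
  assumes "computes idinv E (enc_pair DElem DElem) (\<lambda>x. rep_quot (f x))"
  shows "computes idinv E enc_quot f"
proof -
  have "enc_quot (f x) = enc_pair DElem DElem (rep_quot (f x))" for x
    by (cases "rep_quot (f x)") (simp add: enc_quot_def frac_datum_def)
  with assms show ?thesis unfolding computes_def by simp
qed

lemma computes_q_of [computes_intros]:
  assumes "computes idinv E DElem f"
  shows "computes idinv E enc_quot (\<lambda>x. q_of (f x))"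
  by (rule computes_quot, unfold rep_quot_ops) (rule assms computes_intros)+

lemma computes_q_neg [computes_intros]:
  assumes "computes idinv E enc_quot f"
  shows "computes idinv E enc_quot (\<lambda>x. q_neg (f x))"
  by (rule computes_quot, unfold rep_quot_ops) (rule assms computes_intros)+

lemma computes_q_op [computes_intros]:
  assumes "computes idinv E enc_quot f" "computes idinv E enc_quot g"
  shows "computes idinv E enc_quot (\<lambda>x. q_add (f x) (g x))"
    and "computes idinv E enc_quot (\<lambda>x. q_mult (f x) (g x))"
  by (rule computes_quot, unfold rep_quot_ops, (rule assms computes_intros)+)+

text \<open>\<open>PInv\<close> gets stuck on lists that are entirely zero; there the value \<open>[]\<close> is arbitrary.\<close>

definition ideal_inv :: "('z::idom list \<Rightarrow> ('z \<times> 'z) list) \<Rightarrow> 'z list \<Rightarrow> 'z quot list" where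
  "ideal_inv idinv as = (if fold (\<lambda>a b. if a = 0 then b else False) as True then []
     else map mk_quot (idinv as))"

lemma fold_all_zero: "fold (\<lambda>a b. if a = 0 then b else False) as b \<longleftrightarrow> b \<and> (\<forall>a \<in> set as. a = 0)"
  by (induction as arbitrary: b) auto

lemma computes_bool [computes_intros]:
  "computes idinv E enc_bool (\<lambda>x. True)" "computes idinv E enc_bool (\<lambda>x. False)"
  by (rule computesI[of _ "PPair PNil PNil"], simp add: runs.intros)
    (rule computesI[of _ PNil], simp add: runs.intros)

text \<open>The inversion algorithm returns nonzero denominators, so \<open>mk_quot\<close> loses
  nothing and the output of \<open>PInv\<close> is already the required code.\<close>

lemma computes_ideal_inv:
  assumes "inverts_fg_ideals idinv" "computes idinv E (enc_list DElem) f"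
  shows "computes idinv E (enc_list enc_quot) (\<lambda>x. ideal_inv idinv (f x))"
proof (rule computes_comp[OF assms(2)])
  have "computes idinv (enc_list DElem) enc_bool (\<lambda>as :: 'a list. fold (\<lambda>a b. if a = 0 then b else False) as True)"
    by (rule computes_intros)+
  then obtain p where p: "runs idinv p (enc_list DElem as) (enc_bool (\<forall>a \<in> set as. a = 0))" for as
    unfolding computes_def by (auto simp: fold_all_zero)
  show "computes idinv (enc_list DElem) (enc_list enc_quot) (ideal_inv idinv)"
  proof (rule computesI[of _ "PIf p PNil PInv"])
    fix as
    show "runs idinv (PIf p PNil PInv) (enc_list DElem as) (enc_list enc_quot (ideal_inv idinv as))"
    proof (cases "\<forall>a \<in> set as. a = 0")
      case True
      then show ?thesis using p[of as] by (auto simp: ideal_inv_def fold_all_zero intro: runs.intros(2,7))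
    next
      case False
      with assms(1) have "\<forall>x \<in> set (idinv as). snd x \<noteq> 0"
        by (auto simp: inverts_fg_ideals_def)
      then have "map (enc_quot \<circ> mk_quot) (idinv as) = map frac_datum (idinv as)"
        by (auto simp: enc_quot_def mk_quot_inverse)
      moreover have "ideal_inv idinv as = map mk_quot (idinv as)"
        using False by (auto simp: ideal_inv_def fold_all_zero)
      ultimately have "enc_list enc_quot (ideal_inv idinv as) = list_datum (map frac_datum (idinv as))"
        unfolding enc_list_def by (simp only: map_map)
      moreover have "runs idinv PInv (enc_list DElem as) (list_datum (map frac_datum (idinv as)))"
        unfolding enc_list_def using False by (auto intro: runs.intros(17))
      moreover have "runs idinv p (enc_list DElem as) DNil"
        using p[of as] False by (simp del: enc_bool.simps(1))
      ultimately show ?thesis by (auto intro: runs.intros(8))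
    qed
  qed
qed

section \<open>Invertible ideals\<close>

abbreviation gen :: "'z::idom quot list \<Rightarrow> 'z fract set" where
  "gen us \<equiv> frac_mod.span (val ` set us)"

lemma span_scale_int:
  "r \<in> range to_fract \<Longrightarrow> x \<in> frac_mod.span S \<Longrightarrow> r * x \<in> frac_mod.span S"
  by (auto intro: frac_mod.span_scale)

text \<open>Multiplication by \<open>c\<close> is linear over the domain, so it is enough to look at
  generators.\<close>

lemma span_mult_mem:
  assumes "x \<in> frac_mod.span S" "\<And>s. s \<in> S \<Longrightarrow> c * s \<in> frac_mod.span T"
  shows "c * x \<in> frac_mod.span T"
  using assms(1)
proof (induction rule: frac_mod.span_induct_alt)
  case base
  show ?case using frac_mod.span_zero by simp
next
  case (step r s y)
  have "c * (to_fract r * s + y) = to_fract r * (c * s) + c * y" by (simp add: algebra_simps)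
  then show ?case
    using frac_mod.span_add[OF frac_mod.span_scale[OF assms(2)[OF step(1)]] step(2)] by simp
qed

lemma subspace_range_to_fract: "frac_mod.subspace (range (to_fract :: 'a::idom \<Rightarrow> _))"
  unfolding frac_mod.subspace_def
proof (intro conjI ballI allI)
  show "0 \<in> range (to_fract :: 'a \<Rightarrow> _)"
    by (rule range_eqI[of _ _ 0]) simp
  fix x y :: "'a fract" and c :: 'a
  assume "x \<in> range to_fract"
  then obtain a where a: "x = to_fract a" by blast
  then show "to_fract c * x \<in> range to_fract"
    by (intro range_eqI[of _ _ "c * a"]) simp
  assume "y \<in> range to_fract"
  then obtain b where "y = to_fract b" by blast
  with a show "x + y \<in> range to_fract"
    by (intro range_eqI[of _ _ "a + b"]) simp
qed

text \<open>The product is a submodule, so it contains the ring once it contains 1. The other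
  inclusion is reduced to generators in one factor at a time.\<close>

lemma ideal_prod_span_eq_ring:
  assumes "\<And>x y. x \<in> S \<Longrightarrow> y \<in> T \<Longrightarrow> x * y \<in> range to_fract"
    and "1 \<in> ideal_prod (frac_mod.span S) (frac_mod.span T)"
  shows "ideal_prod (frac_mod.span S) (frac_mod.span T) = range to_fract"
proof
  have ring: "frac_mod.span (range to_fract) = (range to_fract :: 'a fract set)"
    using subspace_range_to_fract frac_mod.span_eq_iff by blast
  have *: "x * y \<in> range to_fract" if "x \<in> S" "y \<in> frac_mod.span T" for x y
    using span_mult_mem[OF that(2), of x "range to_fract"] assms(1)[OF that(1)] unfolding ring by blast
  have "y * x \<in> range to_fract" if "x \<in> frac_mod.span S" "y \<in> frac_mod.span T" for x y
    using span_mult_mem[OF that(1), of y "range to_fract"] *[OF _ that(2)] unfolding ring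
    by (simp add: mult.commute)
  then have "x * y \<in> range to_fract" if "x \<in> frac_mod.span S" "y \<in> frac_mod.span T" for x y
    using that by (simp add: mult.commute)
  then show "ideal_prod (frac_mod.span S) (frac_mod.span T) \<subseteq> range to_fract"
    unfolding ideal_prod_def by (intro frac_mod.span_minimal subspace_range_to_fract) auto
  show "range to_fract \<subseteq> ideal_prod (frac_mod.span S) (frac_mod.span T)"
  proof
    fix z :: "'a fract" assume "z \<in> range to_fract"
    then show "z \<in> ideal_prod (frac_mod.span S) (frac_mod.span T)"
      using span_scale_int[of z 1] assms(2) unfolding ideal_prod_def by simp
  qed
qed

text \<open>The denominator is the product of all denominators, as a domain need not have least
  common multiples.\<close>

definition common_denom :: "'z::idom quot list \<Rightarrow> 'z list \<times> 'z" where
  "common_denom us = foldr (\<lambda>q s. (num q * snd s # map (\<lambda>n. n * den q) (fst s), den q * snd s)) us ([], 1)"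

lemma common_denom:
  "snd (common_denom us) \<noteq> 0"
  "map to_fract (fst (common_denom us)) = map (\<lambda>u. val u * to_fract (snd (common_denom us))) us"
proof -
  have "snd (common_denom us) \<noteq> 0 \<and>
    map to_fract (fst (common_denom us)) = map (\<lambda>u. val u * to_fract (snd (common_denom us))) us"
  proof (induction us)
    case Nil
    show ?case by (simp add: common_denom_def)
  next
    case (Cons q us)
    define c where "c = common_denom us"
    have c: "common_denom (q # us) = (num q * snd c # map (\<lambda>n. n * den q) (fst c), den q * snd c)"
      by (simp add: common_denom_def c_def)
    have IH: "map to_fract (fst c) = map (\<lambda>u. val u * to_fract (snd c)) us" "snd c \<noteq> 0"
      using Cons by (simp_all add: c_def)
    have "map to_fract (map (\<lambda>n. n * den q) (fst c)) = map (\<lambda>x. x * to_fract (den q)) (map to_fract (fst c))"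
      by simp
    also have "\<dots> = map (\<lambda>u. val u * to_fract (den q * snd c)) us"
      unfolding IH(1) by simp
    finally have "map to_fract (map (\<lambda>n. n * den q) (fst c)) = map (\<lambda>u. val u * to_fract (den q * snd c)) us" .
    moreover have "to_fract (num q * snd c) = val q * to_fract (den q * snd c)"
      by (simp add: val_def Fract_conv_to_fract)
    ultimately show ?case using IH(2) unfolding c by simp
  qed
  then show "snd (common_denom us) \<noteq> 0"
    "map to_fract (fst (common_denom us)) = map (\<lambda>u. val u * to_fract (snd (common_denom us))) us" by auto
qed

text \<open>If d is a common denominator for generators of I, then d I is an ideal of the ring, and
  the inverse of I is d times the inverse of d I.\<close>

definition frac_inv :: "('z::idom list \<Rightarrow> ('z \<times> 'z) list) \<Rightarrow> 'z quot list \<Rightarrow> 'z quot list" where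
  "frac_inv idinv us =
     (let c = common_denom us in map (q_mult (q_of (snd c))) (ideal_inv idinv (fst c)))"

text \<open>The factor d only moves from one side of a product to the other: u (d x) = (d u) x. Thus
  the witness and the integrality for d I carry over to I.\<close>

lemma frac_inv:
  fixes us :: "'z::idom quot list"
  assumes "inverts_fg_ideals (idinv :: 'z list \<Rightarrow> ('z \<times> 'z) list)" "\<exists>u \<in> set us. val u \<noteq> 0"
  shows "length (frac_inv idinv us) = length us"
    and "(\<Sum>i < length us. val (us ! i) * val (frac_inv idinv us ! i)) = 1"
    and "\<And>u z. u \<in> set us \<Longrightarrow> z \<in> set (frac_inv idinv us) \<Longrightarrow> val u * val z \<in> range to_fract"
proof -
  obtain ns d where c: "common_denom us = (ns, d)" by fastforce
  have d: "d \<noteq> 0" and ns: "map to_fract ns = map (\<lambda>u. val u * to_fract d) us"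
    using common_denom[of us] by (simp_all add: c)
  have len: "length ns = length us" using ns map_eq_imp_length_eq by blast
  have nth: "to_fract (ns ! i) = val (us ! i) * to_fract d" if "i < length us" for i
    using arg_cong[OF ns, of "\<lambda>l. l ! i"] that len by simp
  have nz: "\<exists>a \<in> set ns. a \<noteq> 0"
  proof -
    obtain i where i: "i < length us" "val (us ! i) \<noteq> 0" using assms(2) by (auto simp: in_set_conv_nth)
    then have "ns ! i \<noteq> 0" using nth[of i] d by auto
    then show ?thesis using i len by auto
  qed
  define xs where "xs = idinv ns"
  have xs: "length xs = length ns" "\<forall>x \<in> set xs. snd x \<noteq> 0"
    "ideal_prod (frac_mod.span (to_fract ` set ns)) (frac_mod.span (frac_val ` set xs)) = range to_fract"
    "(\<Sum>i < length ns. to_fract (ns ! i) * frac_val (xs ! i)) = 1"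
    using assms(1) nz unfolding inverts_fg_ideals_def xs_def by blast+
  have z: "frac_inv idinv us = map (\<lambda>x. q_mult (q_of d) (mk_quot x)) xs"
    using nz by (auto simp: frac_inv_def c ideal_inv_def fold_all_zero xs_def)
  have v: "val (mk_quot x) = frac_val x" if "x \<in> set xs" for x
    using xs(2) that val_mk_quot[of "snd x" "fst x"] by (simp add: frac_val_def)
  show "length (frac_inv idinv us) = length us" using xs(1) len z by simp
  have "val (us ! i) * val (frac_inv idinv us ! i) = to_fract (ns ! i) * frac_val (xs ! i)"
    if "i < length us" for i
    using that nth[OF that] xs(1) len v[of "xs ! i"] by (simp add: z)
  then show "(\<Sum>i < length us. val (us ! i) * val (frac_inv idinv us ! i)) = 1"
    using xs(4) len by simp
  fix u y assume u: "u \<in> set us" and y: "y \<in> set (frac_inv idinv us)"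
  obtain i where i: "i < length us" "u = us ! i" using u by (auto simp: in_set_conv_nth)
  obtain x where x: "x \<in> set xs" "val y = to_fract d * frac_val x" using y v by (auto simp: z)
  have "val u * val y = to_fract (ns ! i) * frac_val x" using nth i x(2) by simp
  also have "\<dots> \<in> ideal_prod (frac_mod.span (to_fract ` set ns)) (frac_mod.span (frac_val ` set xs))"
    unfolding ideal_prod_def using i len x(1) by (intro frac_mod.span_base) (auto intro!: exI frac_mod.span_base)
  finally show "val u * val y \<in> range to_fract" using xs(3) by simp
qed

text \<open>This is why \<open>col_ok\<close> only records a nonzero generator of each column
  ideal.\<close>

lemma invertible_gen:
  fixes us :: "'z::idom quot list"
  assumes "inverts_fg_ideals (idinv :: 'z list \<Rightarrow> ('z \<times> 'z) list)" "\<exists>u \<in> set us. val u \<noteq> 0"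
  shows "invertible_ideal (gen us)"
proof -
  define zs where "zs = frac_inv idinv us"
  note zs = frac_inv[OF assms, folded zs_def]
  have "ideal_prod (gen us) (gen zs) = range to_fract"
  proof (rule ideal_prod_span_eq_ring)
    show "1 \<in> ideal_prod (gen us) (gen zs)"
      unfolding zs(2)[symmetric] ideal_prod_def
      by (intro frac_mod.span_sum frac_mod.span_base) (use zs(1) in \<open>auto intro!: exI frac_mod.span_base\<close>)
  qed (use zs(3) in auto)
  then show ?thesis unfolding invertible_ideal_def fractional_ideal_def by blast
qed

section \<open>Column operations\<close>

definition dot :: "'z::idom quot list \<Rightarrow> 'z quot list \<Rightarrow> 'z quot" where
  "dot u v = foldr q_add (map2 q_mult u v) (q_of 0)"

definition lincomb :: "'z::idom quot \<Rightarrow> 'z quot \<Rightarrow> 'z quot list \<Rightarrow> 'z quot list \<Rightarrow> 'z quot list" where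
  "lincomb x y u v = map2 (\<lambda>s t. q_add (q_mult x s) (q_mult y t)) u v"

lemma length_lincomb [simp]: "length u = length v \<Longrightarrow> length (lincomb x y u v) = length v"
  by (simp add: lincomb_def)

lemma val_lincomb [simp]:
  "i < length u \<Longrightarrow> length u = length v \<Longrightarrow>
   val (lincomb x y u v ! i) = val x * val (u ! i) + val y * val (v ! i)"
  by (simp add: lincomb_def)

lemma val_dot:
  "length u = length v \<Longrightarrow> val (dot u v) = (\<Sum>i < length v. val (u ! i) * val (v ! i))"
proof (induction u v rule: list_induct2)
  case (Cons x xs y ys)
  then show ?case by (simp add: dot_def sum.lessThan_Suc_shift del: sum.lessThan_Suc)
qed (simp add: dot_def)

lemma dot_lincomb_right:
  assumes "length r = length v" "length u = length v"
  shows "val (dot r (lincomb x y u v)) = val x * val (dot r u) + val y * val (dot r v)"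
  using assms by (simp add: val_dot sum_distrib_left sum.distrib algebra_simps)

lemma dot_lincomb_left:
  assumes "length r = length v" "length u = length v"
  shows "val (dot (lincomb x y u v) r) = val x * val (dot u r) + val y * val (dot v r)"
  using assms by (simp add: val_dot sum_distrib_left sum.distrib algebra_simps)

definition products :: "'z::idom quot list \<Rightarrow> 'z quot list \<Rightarrow> 'z quot list" where
  "products us vs = concat (map (\<lambda>u. map (\<lambda>v. q_mult u v) vs) us)"

lemma val_products: "val ` set (products us vs) = {x * y | x y. x \<in> val ` set us \<and> y \<in> val ` set vs}"
  by (force simp: products_def)

text \<open>Generators of the column ideal, the column itself, and the row of the inverse matrix dual to it.\<close>

type_synonym 'z col = "'z quot list \<times> 'z quot list \<times> 'z quot list"

abbreviation col_vec :: "'z::idom col \<Rightarrow> 'z quot list" where "col_vec c \<equiv> fst (snd c)"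
abbreviation col_dual :: "'z::idom col \<Rightarrow> 'z quot list" where "col_dual c \<equiv> snd (snd c)"

text \<open>The generators are padded with zeros so that \<open>x\<close> and \<open>y\<close> are dot products with the same list \<open>Z\<close>
  of elements of the inverse ideal, whose dot product with \<open>U\<close> is 1.\<close>

definition combine :: "('z::idom list \<Rightarrow> ('z \<times> 'z) list) \<Rightarrow> 'z quot \<Rightarrow> 'z quot \<Rightarrow> 'z col \<Rightarrow> 'z col
    \<Rightarrow> 'z col \<times> 'z col" where
  "combine idinv a b k l =
    (let I = fst k @ map (\<lambda>_. q_of 0) (fst l); J = map (\<lambda>_. q_of 0) (fst k) @ fst l;
         U = lincomb a b I J; Z = frac_inv idinv U; x = dot I Z; y = dot J Z
     in ((U, lincomb x y (col_vec k) (col_vec l), lincomb a b (col_dual k) (col_dual l)),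
         (products (products (fst k) (fst l)) Z, lincomb (q_neg b) a (col_vec k) (col_vec l),
          lincomb (q_neg y) x (col_dual k) (col_dual l))))"

text \<open>The last two conditions are the inclusions that a pseudo-matrix requires, for one column
  of C and for the matching row of its inverse. They involve no other column, so a step on two
  columns leaves the rest alone.\<close>

definition col_ok :: "'z::idom quot list list \<Rightarrow> 'z col \<Rightarrow> bool" where
  "col_ok es c \<longleftrightarrow> length (col_vec c) = length es \<and> length (col_dual c) = length es \<and>
     (\<exists>g \<in> set (fst c). val g \<noteq> 0) \<and>
     (\<forall>i < length es. \<forall>g \<in> set (fst c). val (col_vec c ! i) * val g \<in> gen (es ! i)) \<and>
     (\<forall>i < length es. \<forall>t \<in> gen (es ! i). val (col_dual c ! i) * t \<in> gen (fst c))"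

text \<open>Let e, f be the ideals of \<open>k\<close>, \<open>l\<close>, let c be that of
  \<open>k'\<close> and d = e f c^{-1} that of \<open>l'\<close>. From x \<in> e c^{-1} and y \<in>
  f c^{-1} follow x c \<subseteq> e, y c \<subseteq> f, x f \<subseteq> d and y e \<subseteq> d.
  From a e \<subseteq> c and b f \<subseteq> c follow a d \<subseteq> f and b d \<subseteq> e.
  Composed with the old inclusions these give all the new ones.\<close>

lemma combine:
  assumes inv: "inverts_fg_ideals idinv" and k: "col_ok es k" and l: "col_ok es l" and b: "val b \<noteq> 0"
  obtains x y k' l' where "combine idinv a b k l = (k', l')" "val a * val x + val b * val y = 1"
    "col_ok es k'" "col_ok es l'"
    "col_vec k' = lincomb x y (col_vec k) (col_vec l)"
    "col_dual k' = lincomb a b (col_dual k) (col_dual l)"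
    "col_vec l' = lincomb (q_neg b) a (col_vec k) (col_vec l)"
    "col_dual l' = lincomb (q_neg y) x (col_dual k) (col_dual l)"
proof -
  define I where "I = fst k @ map (\<lambda>_. q_of 0) (fst l)"
  define J where "J = map (\<lambda>_. q_of 0) (fst k) @ fst l"
  define U where "U = lincomb a b I J"
  define Z where "Z = frac_inv idinv U"
  define x where "x = dot I Z"
  define y where "y = dot J Z"
  define K where "K = products (products (fst k) (fst l)) Z"
  define k' where "k' = (U, lincomb x y (col_vec k) (col_vec l), lincomb a b (col_dual k) (col_dual l))"
  define l' where "l' = (K, lincomb (q_neg b) a (col_vec k) (col_vec l), lincomb (q_neg y) x (col_dual k) (col_dual l))"
  have len: "length I = length J" "length U = length J" by (simp_all add: I_def J_def U_def)
  \<comment> \<open>Because of the zero padding each half sees only one coefficient, so c is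
    generated by the products a g and b h.\<close>
  have U: "U = lincomb a b (fst k) (map (\<lambda>_. q_of 0) (fst k)) @ lincomb a b (map (\<lambda>_. q_of 0) (fst l)) (fst l)"
    by (simp add: U_def I_def J_def lincomb_def)
  have valU: "val ` set U = (\<lambda>g. val a * val g) ` set (fst k) \<union> (\<lambda>h. val b * val h) ` set (fst l)"
    unfolding U by (force simp: lincomb_def zip_map1 zip_map2 zip_same_conv_map image_iff)
  have K: "val ` set K = {val g * val h * val z | g h z. g \<in> set (fst k) \<and> h \<in> set (fst l) \<and> z \<in> set Z}"
    unfolding K_def val_products by blast
  obtain g0 where g0: "g0 \<in> set (fst k)" "val g0 \<noteq> 0" using k by (auto simp: col_ok_def)
  obtain h0 where h0: "h0 \<in> set (fst l)" "val h0 \<noteq> 0" using l by (auto simp: col_ok_def)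
  have Unz: "\<exists>u \<in> set U. val u \<noteq> 0"
  proof -
    have "val b * val h0 \<in> val ` set U" using h0 valU by blast
    then show ?thesis using b h0 by (metis imageE mult_eq_0_iff)
  qed
  note Z = frac_inv[OF inv Unz, folded Z_def]
  have xy: "val a * val x + val b * val y = 1"
  proof -
    have "val (dot U Z) = 1" using Z(1,2) by (simp add: val_dot)
    then show ?thesis using Z(1) len by (simp add: U_def x_def y_def dot_lincomb_left)
  qed
  \<comment> \<open>A nonzero element of the inverse ideal is needed for a nonzero generator of
    \<open>K\<close>.\<close>
  have Znz: "\<exists>z \<in> set Z. val z \<noteq> 0"
  proof (rule ccontr)
    assume "\<not> ?thesis"
    then have "val x = 0" "val y = 0" using Z(1) len by (simp_all add: x_def y_def val_dot)
    with xy show False by simp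
  qed
  have int: "val z * u \<in> range to_fract" if "u \<in> val ` set U" "z \<in> set Z" for u z
    using Z(3) that by (auto simp: mult.commute)
  have inI: "I ! i \<in> set (fst k) \<or> val (I ! i) = 0" and inJ: "J ! i \<in> set (fst l) \<or> val (J ! i) = 0"
    if "i < length J" for i
    using that by (auto simp: I_def J_def nth_append)
  \<comment> \<open>In this bracketing \<open>val (Z ! i) * t\<close> is integral when t is a
    generator of c; when t is a generator of e or f, the summand is instead regrouped into an
    element of \<open>K\<close> or is zero by padding.\<close>
  have dotZ: "val x * t = (\<Sum>i < length J. val (I ! i) * (val (Z ! i) * t))"
    "val y * t = (\<Sum>i < length J. val (J ! i) * (val (Z ! i) * t))" for t
    using Z(1) len by (simp_all add: x_def y_def val_dot sum_distrib_right mult.assoc)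
  have Zin: "Z ! i \<in> set Z" if "i < length J" for i using Z(1) len that by simp
  have xU: "val x * u \<in> gen (fst k)" and yU: "val y * u \<in> gen (fst l)" if "u \<in> val ` set U" for u
    unfolding dotZ using inI inJ int[OF that Zin] span_scale_int[OF int[OF that Zin] frac_mod.span_base]
    by (auto intro!: frac_mod.span_sum simp: mult.commute[of "val (_ ! _)"] frac_mod.span_zero)
      (metis imageI mult_zero_right frac_mod.span_zero)+
  have xK: "val x * val h \<in> gen K" if "h \<in> set (fst l)" for h
    unfolding dotZ
  proof (rule frac_mod.span_sum)
    fix i assume "i \<in> {..<length J}"
    then have i: "i < length J" by simp
    show "val (I ! i) * (val (Z ! i) * val h) \<in> gen K"
    proof (cases "I ! i \<in> set (fst k)")
      case True
      then have "val (I ! i) * val h * val (Z ! i) \<in> val ` set K" unfolding K using that Zin[OF i] by blast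
      from frac_mod.span_base[OF this] show ?thesis by (simp only: ac_simps)
    qed (use inI[OF i] frac_mod.span_zero in auto)
  qed
  have yK: "val y * val g \<in> gen K" if "g \<in> set (fst k)" for g
    unfolding dotZ
  proof (rule frac_mod.span_sum)
    fix i assume "i \<in> {..<length J}"
    then have i: "i < length J" by simp
    show "val (J ! i) * (val (Z ! i) * val g) \<in> gen K"
    proof (cases "J ! i \<in> set (fst l)")
      case True
      then have "val g * val (J ! i) * val (Z ! i) \<in> val ` set K" unfolding K using that Zin[OF i] by blast
      from frac_mod.span_base[OF this] show ?thesis by (simp only: ac_simps)
    qed (use inJ[OF i] frac_mod.span_zero in auto)
  qed
  have kv: "val (col_vec k ! i) * s \<in> gen (es ! i)" if "i < length es" "s \<in> gen (fst k)" for i s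
    by (rule span_mult_mem[OF that(2)]) (use k that(1) in \<open>auto simp: col_ok_def\<close>)
  have lv: "val (col_vec l ! i) * s \<in> gen (es ! i)" if "i < length es" "s \<in> gen (fst l)" for i s
    by (rule span_mult_mem[OF that(2)]) (use l that(1) in \<open>auto simp: col_ok_def\<close>)
  have kd: "val (col_dual k ! i) * s \<in> gen (fst k)" if "i < length es" "s \<in> gen (es ! i)" for i s
    using k that by (auto simp: col_ok_def)
  have ld: "val (col_dual l ! i) * s \<in> gen (fst l)" if "i < length es" "s \<in> gen (es ! i)" for i s
    using l that by (auto simp: col_ok_def)
  have ln: "length (col_vec k) = length es" "length (col_vec l) = length es"
    "length (col_dual k) = length es" "length (col_dual l) = length es"
    using k l by (auto simp: col_ok_def)
  have k': "col_ok es k'"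
    unfolding col_ok_def
  proof (intro conjI allI impI ballI)
    show "\<exists>g \<in> set (fst k'). val g \<noteq> 0" using Unz by (simp add: k'_def)
  next
    fix i u assume i: "i < length es" and u: "u \<in> set (fst k')"
    then have "val u \<in> val ` set U" by (simp add: k'_def)
    then have "val (col_vec k ! i) * (val x * val u) + val (col_vec l ! i) * (val y * val u) \<in> gen (es ! i)"
      by (intro frac_mod.span_add kv lv i xU yU)
    then show "val (col_vec k' ! i) * val u \<in> gen (es ! i)"
      using i ln by (simp add: k'_def algebra_simps)
  next
    fix i t assume i: "i < length es" and t: "t \<in> gen (es ! i)"
    have "val a * (val (col_dual k ! i) * t) + val b * (val (col_dual l ! i) * t) \<in> gen U"
      by (rule frac_mod.span_add; rule span_mult_mem[OF kd[OF i t]] span_mult_mem[OF ld[OF i t]])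
        (auto intro!: frac_mod.span_base simp: valU)
    then show "val (col_dual k' ! i) * t \<in> gen (fst k')"
      using i ln by (simp add: k'_def algebra_simps)
  qed (use ln in \<open>simp_all add: k'_def\<close>)
  have l': "col_ok es l'"
    unfolding col_ok_def
  proof (intro conjI allI impI ballI)
    obtain z0 where "z0 \<in> set Z" "val z0 \<noteq> 0" using Znz by blast
    then have "val g0 * val h0 * val z0 \<in> val ` set K" "val g0 * val h0 * val z0 \<noteq> 0"
      unfolding K using g0 h0 by auto
    then show "\<exists>g \<in> set (fst l'). val g \<noteq> 0" by (force simp: l'_def)
  next
    fix i u assume i: "i < length es" and u: "u \<in> set (fst l')"
    then have "val u \<in> val ` set K" by (simp add: l'_def)
    then obtain g h z where u: "val u = val g * val h * val z"
      and g: "g \<in> set (fst k)" and h: "h \<in> set (fst l)" and z: "z \<in> set Z"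
      unfolding K by blast
    \<comment> \<open>The factors of g h z are distributed so that a g z and b h z become ring
      coefficients of elements of \<open>gen (es ! i)\<close>.\<close>
    have "val z * (val b * val h) \<in> range to_fract" "val z * (val a * val g) \<in> range to_fract"
      using int g h z valU by blast+
    then have "val z * (val a * val g) * (val (col_vec l ! i) * val h)
        - val z * (val b * val h) * (val (col_vec k ! i) * val g) \<in> gen (es ! i)"
      using g h by (intro frac_mod.span_diff span_scale_int kv lv i frac_mod.span_base) auto
    then show "val (col_vec l' ! i) * val u \<in> gen (es ! i)"
      using i ln by (simp add: l'_def u algebra_simps)
  next
    fix i t assume i: "i < length es" and t: "t \<in> gen (es ! i)"
    have "val x * (val (col_dual l ! i) * t) - val y * (val (col_dual k ! i) * t) \<in> gen K"
      by (rule frac_mod.span_diff; rule span_mult_mem[OF kd[OF i t]] span_mult_mem[OF ld[OF i t]])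
        (auto intro: xK yK)
    then show "val (col_dual l' ! i) * t \<in> gen (fst l')"
      using i ln by (simp add: l'_def algebra_simps)
  qed (use ln in \<open>simp_all add: l'_def\<close>)
  show thesis
  proof (rule that[OF _ xy k' l'])
    show "combine idinv a b k l = (k', l')"
      by (simp add: combine_def Let_def k'_def l'_def K_def x_def y_def Z_def U_def I_def J_def)
  qed (simp_all add: k'_def l'_def)
qed

section \<open>Clearing a row\<close>

text \<open>The first component of the state is an optional pivot, kept as a list of length at most
  one so that the list programs apply. A fraction vanishes exactly when its numerator does, hence
  the test on \<open>num\<close>.\<close>

definition sweep_step :: "('z::idom list \<Rightarrow> ('z \<times> 'z) list) \<Rightarrow> 'z quot list \<Rightarrow> 'z col
    \<Rightarrow> 'z col list \<times> 'z col list \<Rightarrow> 'z col list \<times> 'z col list" where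
  "sweep_step idinv r c s =
    (if num (dot r (col_vec c)) = 0 then (fst s, c # snd s)
     else case fst s of
       [] \<Rightarrow> ([c], snd s)
     | p # _ \<Rightarrow> (let t = combine idinv (dot r (col_vec p)) (dot r (col_vec c)) p c
                in ([fst t], snd t # snd s)))"

definition sweep where "sweep idinv r cs = fold (sweep_step idinv r) cs ([], [])"

text \<open>The sums are the entries of the product of the matrix of columns with the matrix of dual vectors,
  which stays the identity matrix.\<close>

definition col_trans :: "'z::idom quot list list \<Rightarrow> 'z col list \<Rightarrow> 'z col list \<Rightarrow> bool" where
  "col_trans es xs ys \<longleftrightarrow> ((\<forall>c \<in> set xs. col_ok es c) \<longrightarrow>
     (\<forall>c \<in> set ys. col_ok es c) \<and> length ys = length xs \<and>
     (\<forall>i < length es. \<forall>j < length es.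
        (\<Sum>c\<leftarrow>ys. val (col_vec c ! i) * val (col_dual c ! j)) =
        (\<Sum>c\<leftarrow>xs. val (col_vec c ! i) * val (col_dual c ! j))) \<and>
     (\<forall>r. length r = length es \<longrightarrow> (\<forall>c \<in> set xs. val (dot r (col_vec c)) = 0) \<longrightarrow>
        (\<forall>c \<in> set ys. val (dot r (col_vec c)) = 0)))"

lemma col_trans_trans: "col_trans es xs ys \<Longrightarrow> col_trans es ys zs \<Longrightarrow> col_trans es xs zs"
proof -
  assume xy: "col_trans es xs ys" and yz: "col_trans es ys zs"
  show "col_trans es xs zs"
    unfolding col_trans_def
  proof (rule impI)
    assume "\<forall>c \<in> set xs. col_ok es c"
    note 1 = mp[OF xy[unfolded col_trans_def] this]
    note 2 = mp[OF yz[unfolded col_trans_def] conjunct1[OF 1]]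
    show "(\<forall>c \<in> set zs. col_ok es c) \<and> length zs = length xs \<and>
     (\<forall>i < length es. \<forall>j < length es.
        (\<Sum>c\<leftarrow>zs. val (col_vec c ! i) * val (col_dual c ! j)) =
        (\<Sum>c\<leftarrow>xs. val (col_vec c ! i) * val (col_dual c ! j))) \<and>
     (\<forall>r. length r = length es \<longrightarrow> (\<forall>c \<in> set xs. val (dot r (col_vec c)) = 0) \<longrightarrow>
        (\<forall>c \<in> set zs. val (dot r (col_vec c)) = 0))"
      (is "_ \<and> _ \<and> ?sum \<and> ?zero")
    proof (intro conjI)
      show ?sum
        using conjunct1[OF conjunct2[OF conjunct2[OF 1]]] conjunct1[OF conjunct2[OF conjunct2[OF 2]]]
        by presburger
      show ?zero
        using conjunct2[OF conjunct2[OF conjunct2[OF 1]]] conjunct2[OF conjunct2[OF conjunct2[OF 2]]]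
        by blast
    qed (use 1 2 in auto)
  qed
qed

text \<open>Everything recorded in \<open>col_trans\<close> is symmetric in the columns; their order
  matters only for the triangular shape.\<close>

lemma col_trans_mset:
  assumes "mset xs = mset ys"
  shows "col_trans es xs ys"
proof -
  have "(\<Sum>c\<leftarrow>ys. f c) = (\<Sum>c\<leftarrow>xs. f c)" for f :: "'a col \<Rightarrow> 'a fract"
    using assms by (metis mset_map sum_mset_sum_list)
  then show ?thesis
    using mset_eq_setD[OF assms] mset_eq_length[OF assms] unfolding col_trans_def by auto
qed

lemma col_trans_append: "col_trans es xs ys \<Longrightarrow> col_trans es (xs @ zs) (ys @ zs)"
  unfolding col_trans_def by auto

text \<open>The columns are multiplied by a matrix of determinant a x + b y = 1 and the duals by its
  inverse, which preserves the sum of outer products. The new columns are combinations of the old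
  ones, so a row that vanishes on both old columns vanishes on both new ones.\<close>

lemma col_trans_combine:
  assumes inv: "inverts_fg_ideals idinv" and k: "col_ok es k" and l: "col_ok es l" and b: "val b \<noteq> 0"
    and c: "combine idinv a b k l = (k', l')"
  shows "col_trans es [k, l] [k', l']"
proof -
  obtain x y where xy: "val a * val x + val b * val y = 1"
    "col_ok es k'" "col_ok es l'"
    "col_vec k' = lincomb x y (col_vec k) (col_vec l)"
    "col_dual k' = lincomb a b (col_dual k) (col_dual l)"
    "col_vec l' = lincomb (q_neg b) a (col_vec k) (col_vec l)"
    "col_dual l' = lincomb (q_neg y) x (col_dual k) (col_dual l)"
    using combine[OF inv k l b, of a] c by (metis Pair_inject)
  have ln: "length (col_vec k) = length es" "length (col_vec l) = length es"
    "length (col_dual k) = length es" "length (col_dual l) = length es"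
    using k l by (auto simp: col_ok_def)
  have "(\<Sum>c\<leftarrow>[k', l']. val (col_vec c ! i) * val (col_dual c ! j)) =
        (\<Sum>c\<leftarrow>[k, l]. val (col_vec c ! i) * val (col_dual c ! j))"
    if ij: "i < length es" "j < length es" for i j
  proof -
    define A B C D where "A = val (col_vec k ! i)" and "B = val (col_vec l ! i)"
      and "C = val (col_dual k ! j)" and "D = val (col_dual l ! j)"
    have "(\<Sum>c\<leftarrow>[k', l']. val (col_vec c ! i) * val (col_dual c ! j)) =
      (val x * A + val y * B) * (val a * C + val b * D)
      + (- val b * A + val a * B) * (- val y * C + val x * D)"
      using ij ln by (simp add: xy A_def B_def C_def D_def)
    also have "\<dots> = (val a * val x + val b * val y) * (A * C + B * D)"
      by (simp add: algebra_simps)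
    finally show ?thesis by (simp add: xy(1) A_def B_def C_def D_def)
  qed
  moreover have "val (dot r (col_vec k')) = 0 \<and> val (dot r (col_vec l')) = 0"
    if "length r = length es" "val (dot r (col_vec k)) = 0" "val (dot r (col_vec l)) = 0" for r
    using that ln by (simp add: xy dot_lincomb_right)
  ultimately show ?thesis using xy(2,3) unfolding col_trans_def by auto
qed

lemma sweep_fold:
  assumes inv: "inverts_fg_ideals idinv" and r: "length r = length es"
    and "\<forall>c \<in> set (fst s @ snd s @ cs). col_ok es c"
    and "\<forall>c \<in> set (snd s). val (dot r (col_vec c)) = 0"
    and "fst s = [] \<or> (\<exists>p. fst s = [p] \<and> val (dot r (col_vec p)) \<noteq> 0)"
    and "fold (sweep_step idinv r) cs s = (piv, out)"
  shows "col_trans es (fst s @ snd s @ cs) (piv @ out) \<and>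
    (\<forall>c \<in> set out. val (dot r (col_vec c)) = 0) \<and>
    (piv = [] \<or> (\<exists>p. piv = [p] \<and> val (dot r (col_vec p)) \<noteq> 0))"
  using assms(3-)
proof (induction cs arbitrary: s)
  case Nil
  then show ?case using col_trans_mset[of "piv @ out" "piv @ out"] by auto
next
  case (Cons c cs)
  define s' where "s' = sweep_step idinv r c s"
  have "col_trans es (fst s @ snd s @ c # cs) (fst s' @ snd s' @ cs) \<and>
    (\<forall>c \<in> set (snd s'). val (dot r (col_vec c)) = 0) \<and>
    (fst s' = [] \<or> (\<exists>p. fst s' = [p] \<and> val (dot r (col_vec p)) \<noteq> 0))"
  proof (cases "val (dot r (col_vec c)) = 0")
    case True
    then have s': "s' = (fst s, c # snd s)" by (simp add: s'_def sweep_step_def val_eq_0_iff)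
    have "col_trans es (fst s @ snd s @ c # cs) (fst s' @ snd s' @ cs)"
      by (rule col_trans_mset) (simp add: s')
    then show ?thesis using Cons.prems True by (auto simp: s')
  next
    case nz: False
    show ?thesis
    proof (cases "fst s = []")
      case True
      then have s': "s' = ([c], snd s)" using nz by (simp add: s'_def sweep_step_def val_eq_0_iff)
      have "col_trans es (fst s @ snd s @ c # cs) (fst s' @ snd s' @ cs)"
        by (rule col_trans_mset) (simp add: s' True)
      then show ?thesis using Cons.prems nz by (auto simp: s')
    next
      case False
      then obtain p where p: "fst s = [p]" "val (dot r (col_vec p)) \<noteq> 0" using Cons.prems by auto
      have ok: "col_ok es p" "col_ok es c" using Cons.prems p by auto
      obtain x y k l where kl: "combine idinv (dot r (col_vec p)) (dot r (col_vec c)) p c = (k, l)"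
        "val (dot r (col_vec p)) * val x + val (dot r (col_vec c)) * val y = 1"
        "col_vec k = lincomb x y (col_vec p) (col_vec c)"
        "col_vec l = lincomb (q_neg (dot r (col_vec c))) (dot r (col_vec p)) (col_vec p) (col_vec c)"
        by (rule combine[OF inv ok nz]) blast
      have ln: "length (col_vec p) = length es" "length (col_vec c) = length es"
        using ok by (auto simp: col_ok_def)
      have s': "s' = ([k], l # snd s)"
        using nz p by (simp add: s'_def sweep_step_def val_eq_0_iff kl(1))
      have "val (dot r (col_vec k)) = 1" "val (dot r (col_vec l)) = 0"
        using kl(2) ln r by (simp_all add: kl(3,4) dot_lincomb_right mult.commute)
      moreover have "col_trans es (fst s @ snd s @ c # cs) (fst s' @ snd s' @ cs)"
      proof -
        \<comment> \<open>Reordering brings the two combined columns to the front, where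
          \<open>col_trans_append\<close> can replace them.\<close>
        have "col_trans es (fst s @ snd s @ c # cs) ([p, c] @ snd s @ cs)"
          by (rule col_trans_mset) (simp add: p)
        moreover have "col_trans es ([p, c] @ snd s @ cs) ([k, l] @ snd s @ cs)"
          by (rule col_trans_append[OF col_trans_combine[OF inv ok nz kl(1)]])
        ultimately show ?thesis using col_trans_trans by (simp add: s') blast
      qed
      ultimately show ?thesis using Cons.prems by (auto simp: s')
    qed
  qed
  note s' = this
  have ok: "\<forall>c \<in> set (fst s' @ snd s' @ cs). col_ok es c"
    using s' Cons.prems(1) unfolding col_trans_def by blast
  have "fold (sweep_step idinv r) cs s' = (piv, out)" using Cons.prems(4) by (simp add: s'_def)
  from Cons.IH[OF ok _ _ this] s' show ?case using col_trans_trans by blast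
qed

lemma sweep:
  assumes "inverts_fg_ideals idinv" "length r = length es" "\<forall>c \<in> set cs. col_ok es c"
    "sweep idinv r cs = (piv, out)"
  shows "col_trans es cs (piv @ out)" "\<forall>c \<in> set out. val (dot r (col_vec c)) = 0"
    "piv = [] \<or> (\<exists>p. piv = [p] \<and> val (dot r (col_vec p)) \<noteq> 0)"
  using sweep_fold[OF assms(1,2), of "([], [])" cs piv out] assms(3,4) by (auto simp: sweep_def)

section \<open>The reduction\<close>

text \<open>The state consists of the pivot columns, the remaining columns and the labels of the pivot rows
  and of the other rows among those treated so far.\<close>

definition row_step where
  "row_step idinv x s =
    (let t = sweep idinv (fst x) (fst (snd s)) in
     case fst t of
       [] \<Rightarrow> (fst s, snd t, fst (snd (snd s)), snd (snd (snd s)) @ [snd x])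
     | p # _ \<Rightarrow> (fst s @ [p], snd t, fst (snd (snd s)) @ [snd x], snd (snd (snd s))))"

text \<open>The indices \<open>ps\<close> and \<open>qs\<close> of pivot and other rows exist only
  in the statement, while the program handles the labels \<open>u\<close>. Leaving \<open>u\<close>
  arbitrary allows unit vectors as labels later.\<close>

lemma fold_row_step:
  assumes inv: "inverts_fg_ideals idinv" and R: "\<forall>i < n. length (R i) = length es"
    and cs: "\<forall>c \<in> set cs. col_ok es c"
  shows "\<exists>piv act ps qs.
    fold (row_step idinv) (map (\<lambda>i. (R i, u i)) [0..<n]) ([], cs, [], []) = (piv, act, map u ps, map u qs) \<and>
    col_trans es cs (piv @ act) \<and> distinct (ps @ qs) \<and> set (ps @ qs) = {..<n} \<and> length piv = length ps \<and>
    (\<forall>i < n. \<forall>c \<in> set act. val (dot (R i) (col_vec c)) = 0) \<and>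
    (\<forall>k < length ps. val (dot (R (ps ! k)) (col_vec (piv ! k))) \<noteq> 0) \<and>
    (\<forall>l < length ps. \<forall>k < l. val (dot (R (ps ! k)) (col_vec (piv ! l))) = 0)"
  using R
proof (induction n)
  case 0
  show ?case using col_trans_mset[of cs cs] by simp
next
  case (Suc n)
  have "\<forall>i < n. length (R i) = length es" using Suc.prems by simp
  from Suc.IH[OF this] obtain piv act ps qs where IH:
    "fold (row_step idinv) (map (\<lambda>i. (R i, u i)) [0..<n]) ([], cs, [], []) = (piv, act, map u ps, map u qs)"
    "col_trans es cs (piv @ act)" "distinct (ps @ qs)" "set (ps @ qs) = {..<n}" "length piv = length ps"
    "\<forall>i < n. \<forall>c \<in> set act. val (dot (R i) (col_vec c)) = 0"
    "\<forall>k < length ps. val (dot (R (ps ! k)) (col_vec (piv ! k))) \<noteq> 0"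
    "\<forall>l < length ps. \<forall>k < l. val (dot (R (ps ! k)) (col_vec (piv ! l))) = 0"
    by (elim exE conjE) (rule that; assumption)
  have ok: "\<forall>c \<in> set (piv @ act). col_ok es c" using IH(2) cs unfolding col_trans_def by blast
  obtain new out where sw: "sweep idinv (R n) act = (new, out)" by fastforce
  have "length (R n) = length es" using Suc.prems by simp
  note sweep = sweep[OF inv this _ sw]
  have act: "\<forall>c \<in> set act. col_ok es c" using ok by auto
  have tr: "col_trans es cs ((piv @ new) @ out)"
  proof -
    have "col_trans es (piv @ act) (act @ piv)" by (rule col_trans_mset) simp
    moreover have "col_trans es (act @ piv) ((new @ out) @ piv)"
      by (rule col_trans_append[OF sweep(1)[OF act]])
    moreover have "col_trans es ((new @ out) @ piv) ((piv @ new) @ out)" by (rule col_trans_mset) simp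
    ultimately show ?thesis using IH(2) col_trans_trans by blast
  qed
  \<comment> \<open>By the last condition of \<open>col_trans\<close>, zeros of the remaining
    columns in earlier rows pass to the new pivot and to the new remaining columns.\<close>
  have zero: "val (dot (R i) (col_vec c)) = 0" if "i < n" "c \<in> set (new @ out)" for i c
  proof -
    have "length (R i) = length es" using Suc.prems that by simp
    then show ?thesis using sweep(1)[OF act] IH(6) that act unfolding col_trans_def by blast
  qed
  have zero': "\<forall>i < Suc n. \<forall>c \<in> set out. val (dot (R i) (col_vec c)) = 0"
    using zero sweep(2)[OF act] by (auto simp: less_Suc_eq)
  show ?case
  proof (cases "new = []")
    case True
    have "fold (row_step idinv) (map (\<lambda>i. (R i, u i)) [0..<Suc n]) ([], cs, [], []) =
        (piv, out, map u ps, map u (qs @ [n]))"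
      by (simp add: IH(1) row_step_def sw True)
    moreover have "distinct (ps @ qs @ [n])" "set (ps @ qs @ [n]) = {..<Suc n}"
      using IH(3,4) by auto
    moreover have "col_trans es cs (piv @ out)" using tr True by simp
    ultimately show ?thesis using IH(5,7,8) zero'
      by (intro exI[of _ piv] exI[of _ out] exI[of _ ps] exI[of _ "qs @ [n]"] conjI)
  next
    case False
    then obtain p where p: "new = [p]" "val (dot (R n) (col_vec p)) \<noteq> 0" using sweep(3)[OF act] by auto
    have "fold (row_step idinv) (map (\<lambda>i. (R i, u i)) [0..<Suc n]) ([], cs, [], []) =
        (piv @ [p], out, map u (ps @ [n]), map u qs)"
      by (simp add: IH(1) row_step_def sw p)
    moreover have "distinct ((ps @ [n]) @ qs)" "set ((ps @ [n]) @ qs) = {..<Suc n}"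
      using IH(3,4) by auto
    moreover have "length (piv @ [p]) = length (ps @ [n])" using IH(5) by simp
    moreover have "\<forall>k < length (ps @ [n]). val (dot (R ((ps @ [n]) ! k)) (col_vec ((piv @ [p]) ! k))) \<noteq> 0"
      using IH(5,7) p by (auto simp: nth_append less_Suc_eq)
    moreover have "\<forall>l < length (ps @ [n]). \<forall>k < l. val (dot (R ((ps @ [n]) ! k)) (col_vec ((piv @ [p]) ! l))) = 0"
    proof (intro allI impI)
      fix l k assume l: "l < length (ps @ [n])" and k: "k < l"
      show "val (dot (R ((ps @ [n]) ! k)) (col_vec ((piv @ [p]) ! l))) = 0"
      proof (cases "l < length ps")
        case True
        then show ?thesis using IH(5,8) k by (simp add: nth_append)
      next
        case False
        then have "k < length ps" "l = length ps" using l k by auto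
        moreover have "ps ! k < n" using IH(4) \<open>k < length ps\<close> by (metis Un_iff lessThan_iff nth_mem set_append)
        ultimately show ?thesis using zero p(1) IH(5) by (simp add: nth_append)
      qed
    qed
    moreover have "col_trans es cs ((piv @ [p]) @ out)" using tr p(1) by simp
    ultimately show ?thesis using zero'
      by (intro exI[of _ "piv @ [p]"] exI[of _ out] exI[of _ "ps @ [n]"] exI[of _ qs] conjI)
  qed
qed

text \<open>The identity matrix, enlarged by one row and one column per list element; programs have
  no numbers, so a list stands for its size.\<close>

definition unit_rows :: "'b list \<Rightarrow> 'z::idom list list" where
  "unit_rows xs = foldr (\<lambda>_ I. (1 # map (\<lambda>_. 0) I) # map ((#) 0) I) xs []"

lemma unit_rows:
  "unit_rows xs = map (\<lambda>i. map (\<lambda>j. if j = i then 1 else 0 :: 'z::idom) [0..<length xs]) [0..<length xs]"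
proof (induction xs)
  case (Cons x xs)
  have "unit_rows (x # xs) = (1 # map (\<lambda>_. 0) (unit_rows xs :: 'z list list)) # map ((#) (0 :: 'z)) (unit_rows xs)"
    by (simp add: unit_rows_def)
  also have "\<dots> = map (\<lambda>i. map (\<lambda>j. if j = i then 1 else 0) [0..<length (x # xs)]) [0..<length (x # xs)]"
    unfolding Cons by (simp add: upt_conv_Cons map_Suc_upt[symmetric] comp_def del: upt_Suc)
  finally show ?case .
qed (simp add: unit_rows_def)

text \<open>The argument \<open>xs\<close> only supplies the number of rows, which matters if \<open>cs\<close> is empty.\<close>

definition transpose_cols :: "'b list \<Rightarrow> 'a list list \<Rightarrow> 'a list list" where
  "transpose_cols xs cs = foldr (map2 (#)) cs (map (\<lambda>_. []) xs)"

lemma transpose_cols: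
  assumes "\<forall>c \<in> set cs. length c = length xs"
  shows "transpose_cols xs cs = map (\<lambda>i. map (\<lambda>c. c ! i) cs) [0..<length xs]"
  using assms
proof (induction cs)
  case Nil
  then show ?case by (simp add: transpose_cols_def map_replicate_const)
next
  case (Cons c cs)
  have "transpose_cols xs (c # cs) = map2 (#) c (transpose_cols xs cs)" by (simp add: transpose_cols_def)
  also have "\<dots> = map (\<lambda>i. map (\<lambda>c. c ! i) (c # cs)) [0..<length xs]"
    using Cons by (intro nth_equalityI) auto
  finally show ?case .
qed

section \<open>The reduction as a function on lists\<close>

type_synonym 'z input = "'z quot list list \<times> 'z quot list list \<times> 'z quot list list"

definition init_cols :: "'z::idom quot list list \<Rightarrow> 'z col list" where
  "init_cols es = map2 (\<lambda>e u. (e, u, u)) es (map (map q_of) (unit_rows es))"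

text \<open>Each row is labelled by its unit vector, so listing the labels of the pivot rows and
  then the others yields the rows of the permutation matrix.\<close>

definition hermite ::
  "('z::idom list \<Rightarrow> ('z \<times> 'z) list) \<Rightarrow> 'z input \<Rightarrow> 'z list list \<times> 'z input" where
  "hermite idinv d =
    (let es = fst (snd d);
         s = fold (row_step idinv) (map2 Pair (snd (snd d)) (unit_rows (fst d))) ([], init_cols es, [], []);
         cs = fst s @ fst (snd s)
     in (fst (snd (snd s)) @ snd (snd (snd s)), (es, (map fst cs, transpose_cols es (map col_vec cs)))))"

text \<open>The zero ideal has only zero products, which cannot contain 1. This supplies the nonzero
  generator for the initial columns.\<close>

lemma invertible_gen_nonzero:
  assumes "invertible_ideal (gen us)"
  shows "\<exists>u \<in> set us. val u \<noteq> 0"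
proof (rule ccontr)
  assume "\<not> ?thesis"
  then have "val ` set us \<subseteq> {0}" by auto
  then have "gen us \<subseteq> {0}" by (intro frac_mod.span_minimal) simp_all
  then have "ideal_prod (gen us) J \<subseteq> {0}" for J
    unfolding ideal_prod_def by (intro frac_mod.span_minimal) auto
  moreover obtain J where "ideal_prod (gen us) J = range to_fract"
    using assms by (auto simp: invertible_ideal_def)
  moreover have "(1 :: 'a fract) \<in> range to_fract" by (rule range_eqI[of _ _ 1]) simp
  ultimately show False by (metis singletonD subsetD zero_neq_one)
qed

lemma init_cols:
  assumes "\<forall>e \<in> set es. invertible_ideal (gen e)"
  shows "length (init_cols es) = length es" "\<forall>c \<in> set (init_cols es). col_ok es c"
    and "\<And>i j. i < length es \<Longrightarrow> j < length es \<Longrightarrow>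
      (\<Sum>c\<leftarrow>init_cols es. val (col_vec c ! i) * val (col_dual c ! j)) = (if i = j then 1 else 0)"
proof -
  define u where "u k = map (\<lambda>j. q_of (if j = k then 1 else 0 :: 'a)) [0..<length es]" for k
  have *: "init_cols es = map (\<lambda>k. (es ! k, u k, u k)) [0..<length es]"
    unfolding init_cols_def unit_rows u_def by (intro nth_equalityI) simp_all
  have u: "length (u k) = length es" "i < length es \<Longrightarrow> val (u k ! i) = (if i = k then 1 else 0)" for i k
    by (simp_all add: u_def)
  show "length (init_cols es) = length es" by (simp add: *)
  have "col_ok es (es ! k, u k, u k)" if "k < length es" for k
    using assms that invertible_gen_nonzero[of "es ! k"]
    by (auto simp: col_ok_def u frac_mod.span_zero intro: frac_mod.span_base)
  then show "\<forall>c \<in> set (init_cols es). col_ok es c" by (auto simp: *)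
  fix i j assume "i < length es" and "j < length es"
  have "(\<Sum>c\<leftarrow>init_cols es. val (col_vec c ! i) * val (col_dual c ! j)) =
      (\<Sum>k < length es. val (u k ! i) * val (u k ! j))"
    unfolding * by (simp add: sum_list_sum_nth atLeast0LessThan)
  also have "\<dots> = (\<Sum>k < length es. if k = i then (if i = j then 1 else 0) else 0)"
    using \<open>i < length es\<close> \<open>j < length es\<close> by (intro sum.cong) (auto simp: u(2))
  finally show "(\<Sum>c\<leftarrow>init_cols es. val (col_vec c ! i) * val (col_dual c ! j)) = (if i = j then 1 else 0)"
    using \<open>i < length es\<close> by simp
qed

section \<open>From lists to matrices: correctness\<close>

lemma reduced_hermite_formI:
  fixes M :: "'a::idom mat"
  assumes M: "M \<in> carrier_mat n m" and r: "r \<le> n" "r \<le> m"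
    and diag: "\<And>i. i < r \<Longrightarrow> M $$ (i, i) \<noteq> 0"
    and upper: "\<And>i j. i < j \<Longrightarrow> j < r \<Longrightarrow> M $$ (i, j) = 0"
    and zero: "\<And>i j. i < n \<Longrightarrow> r \<le> j \<Longrightarrow> j < m \<Longrightarrow> M $$ (i, j) = 0"
  shows "reduced_hermite_form M"
proof -
  define T where "T = mat r r (\<lambda>(i, j). M $$ (i, j))"
  define G where "G = mat (n - r) r (\<lambda>(i, j). M $$ (i + r, j))"
  have T: "T \<in> carrier_mat r r" by (simp add: T_def)
  have tri: "\<And>i j. i < j \<Longrightarrow> j < r \<Longrightarrow> T $$ (i, j) = 0" using upper by (simp add: T_def)
  have "det T = prod_list (diag_mat T)"
    by (rule det_lower_triangular[OF _ T]) (rule tri)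
  then have "det T \<noteq> 0"
    using diag by (auto simp: diag_mat_def prod_list_zero_iff T_def)
  moreover have "M = four_block_mat T (0\<^sub>m r (m - r)) G (0\<^sub>m (n - r) (m - r))"
    by (rule eq_matI) (use M r zero in \<open>auto simp: T_def G_def\<close>)
  ultimately show ?thesis unfolding reduced_hermite_form_def
    by (intro exI[of _ r] exI[of _ "n - r"] exI[of _ "m - r"] exI[of _ T] exI[of _ G])
      (use T tri in \<open>auto simp: G_def\<close>)
qed

lemma index_mult_mat_sum:
  assumes "A \<in> carrier_mat n k" "B \<in> carrier_mat k m" "i < n" "j < m"
  shows "(A * B) $$ (i, j) = (\<Sum>l = 0..<k. A $$ (i, l) * B $$ (l, j))"
  using assms by (simp add: scalar_prod_def)

text \<open>The dual rows are absent from the output; here they form the matrix \<open>N\<close>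
  that certifies the invertibility of \<open>C\<close>.\<close>

lemma hermite_correct:
  fixes A :: "'z::idom fract pmat"
  assumes inv: "inverts_fg_ideals idinv" and A: "pseudo_matrix A"
    and hs: "row_ideals A = map gen hs" and es: "col_ideals A = map gen es"
    and rs: "mat_to_list (entries A) = map (map val) rs"
    and out: "hermite idinv (hs, es, rs) = (us, es', gs, cs)"
  shows "\<exists>L C. hermite_reduction A L C \<and> mat_to_list L = us \<and> row_ideals C = map gen es' \<and>
    col_ideals C = map gen gs \<and> mat_to_list (entries C) = map (map val) cs"
proof -
  define n where "n = length hs"
  define m where "m = length es"
  have Acarr: "entries A \<in> carrier_mat n m"
    using A by (simp add: pseudo_matrix_def hs es n_def m_def)
  have rsl: "length rs = n"
    using arg_cong[OF rs, of length] Acarr by (simp add: mat_to_list_def)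
  have rs_row: "map val (rs ! i) = map (\<lambda>j. entries A $$ (i, j)) [0..<m]" if "i < n" for i
    using arg_cong[OF rs, of "\<lambda>l. l ! i"] Acarr that rsl by (simp add: mat_to_list_def)
  have rs_len: "\<forall>i < n. length (rs ! i) = length es"
    using rs_row map_eq_imp_length_eq by (fastforce simp: m_def)
  have rs_val: "val (rs ! i ! j) = entries A $$ (i, j)" if "i < n" "j < m" for i j
    using arg_cong[OF rs_row[OF that(1)], of "\<lambda>l. l ! j"] that rs_len by (simp add: m_def)
  have einv: "\<forall>e \<in> set es. invertible_ideal (gen e)" using A by (auto simp: pseudo_matrix_def es)
  note init = init_cols[OF einv]
  define u where "u i = map (\<lambda>j. if j = i then 1 else 0 :: 'z) [0..<n]" for i
  have input: "zip rs (unit_rows hs) = map (\<lambda>i. (rs ! i, u i)) [0..<n]"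
    unfolding unit_rows u_def n_def[symmetric] by (intro nth_equalityI) (simp_all add: rsl)
  obtain piv act ps qs where fold:
    "fold (row_step idinv) (map (\<lambda>i. (rs ! i, u i)) [0..<n]) ([], init_cols es, [], []) = (piv, act, map u ps, map u qs)"
    and tr: "col_trans es (init_cols es) (piv @ act)" and dist: "distinct (ps @ qs)"
    and sets: "set (ps @ qs) = {..<n}" and plen: "length piv = length ps"
    and zero: "\<forall>i < n. \<forall>c \<in> set act. val (dot (rs ! i) (col_vec c)) = 0"
    and diag: "\<forall>k < length ps. val (dot (rs ! (ps ! k)) (col_vec (piv ! k))) \<noteq> 0"
    and upper: "\<forall>l < length ps. \<forall>k < l. val (dot (rs ! (ps ! k)) (col_vec (piv ! l))) = 0"
    using fold_row_step[OF inv rs_len init(2), of u] by (elim exE conjE) (rule that; assumption)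
  define cols where "cols = piv @ act"
  have us: "us = map u (ps @ qs)" and es': "es' = es" and gs: "gs = map fst cols"
    and cs: "cs = transpose_cols es (map col_vec cols)"
    using out by (auto simp: hermite_def input fold cols_def Let_def)
  have ok: "\<forall>c \<in> set cols. col_ok es c" and clen: "length cols = m"
    and delta: "\<And>i j. i < m \<Longrightarrow> j < m \<Longrightarrow>
      (\<Sum>c\<leftarrow>cols. val (col_vec c ! i) * val (col_dual c ! j)) = (if i = j then 1 else 0)"
    using tr[unfolded col_trans_def, rule_format, OF init(2)[rule_format]] init(1,3)
    by (auto simp: cols_def m_def)
  have okn: "col_ok es (cols ! j)" if "j < m" for j using ok clen that by simp
  have vlen: "length (col_vec (cols ! j)) = m" if "j < m" for j
    using okn[OF that] by (simp add: col_ok_def m_def)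
  define P where "P = ps @ qs"
  have Plen: "length P = n" using distinct_card[OF dist] sets by (simp add: P_def)
  have Pn: "P ! i < n" if "i < n" for i using sets that Plen nth_mem unfolding P_def by blast
  \<comment> \<open>Outside \<open>{..<n}\<close> the value is \<open>i\<close>, since
    \<open>permutes\<close> demands fixed points there.\<close>
  define \<sigma> where "\<sigma> i = (if i < n then P ! i else i)" for i
  have perm: "\<sigma> permutes {..<n}"
  proof (rule bij_imp_permutes)
    have "bij_betw ((!) P) {..<length P} (set P)"
      by (rule bij_betw_nth) (use dist in \<open>simp_all add: P_def\<close>)
    then have "bij_betw ((!) P) {..<n} {..<n}" using sets Plen by (simp add: P_def)
    then show "bij_betw \<sigma> {..<n} {..<n}" by (rule bij_betw_cong[THEN iffD1, rotated]) (simp add: \<sigma>_def)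
  qed (simp add: \<sigma>_def)
  define Cm where "Cm = mat m m (\<lambda>(i, j). val (col_vec (cols ! j) ! i))"
  define N where "N = mat m m (\<lambda>(i, j). val (col_dual (cols ! i) ! j))"
  define C where "C = PMat (map gen es) (map gen gs) Cm"
  define L where "L = (perm_mat n \<sigma> :: 'z mat)"
  \<comment> \<open>The entries of this product are the sums that \<open>col_trans\<close> keeps at
    their initial values.\<close>
  have CN: "Cm * N = 1\<^sub>m m"
    using delta clen
    by (intro eq_matI) (simp_all add: Cm_def N_def scalar_prod_def sum_list_sum_nth)
  \<comment> \<open>The number of columns is preserved, so the matrices are square over a field and
    a one-sided inverse is two-sided.\<close>
  have NC: "N * Cm = 1\<^sub>m m"
    by (rule mat_mult_left_right_inverse[OF _ _ CN]) (simp_all add: Cm_def N_def)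
  have iinv: "\<forall>e \<in> set (map gen gs). invertible_ideal e"
    using ok invertible_gen[OF inv] by (auto simp: gs col_ok_def)
  have Cpm: "pseudo_matrix C"
  proof -
    have "val (col_vec (cols ! j) ! i) * t \<in> gen (es ! i)" if "i < m" "j < m" "t \<in> gen (fst (cols ! j))" for i j t
      by (rule span_mult_mem[OF that(3)]) (use okn that(1,2) in \<open>auto simp: col_ok_def m_def\<close>)
    then show ?thesis using einv iinv clen
      by (auto simp: pseudo_matrix_def C_def Cm_def gs m_def)
  qed
  have Npm: "pseudo_matrix (PMat (map gen gs) (map gen es) N)"
    using einv iinv clen okn by (auto simp: pseudo_matrix_def N_def gs m_def col_ok_def)
  have Cinv: "invertible_pmat C"
    unfolding invertible_pmat_def using Cpm Npm CN NC clen
    by (auto simp: C_def gs m_def inverts_mat_def Cm_def N_def intro!: exI[of _ N])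
  define M where "M = (map_mat to_fract (perm_mat n \<sigma>) * entries A) * Cm"
  have Mcarr: "M \<in> carrier_mat n m"
    unfolding M_def by (rule mult_carrier_mat[OF mult_carrier_mat[OF _ Acarr]]) (simp_all add: perm_mat_def Cm_def)
  have M: "M $$ (i, j) = val (dot (rs ! (P ! i)) (col_vec (cols ! j)))" if ij: "i < n" "j < m" for i j
  proof -
    define Q where "Q = (map_mat to_fract (perm_mat n \<sigma>) :: 'z fract mat)"
    have Q: "Q \<in> carrier_mat n n" by (simp add: Q_def perm_mat_def)
    have Qi: "Q $$ (i, l) = (if l = P ! i then 1 else 0)" if "l < n" for l
      using that ij(1) by (simp add: Q_def perm_mat_def \<sigma>_def)
    have QA: "(Q * entries A) $$ (i, k) = entries A $$ (P ! i, k)" if k: "k < m" for k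
    proof -
      have "(Q * entries A) $$ (i, k) = (\<Sum>l = 0..<n. Q $$ (i, l) * entries A $$ (l, k))"
        by (rule index_mult_mat_sum[OF Q Acarr ij(1) k])
      also have "\<dots> = (\<Sum>l = 0..<n. if l = P ! i then entries A $$ (l, k) else 0)"
        by (rule sum.cong) (simp_all add: Qi)
      finally show ?thesis using Pn[OF ij(1)] by simp
    qed
    have "M $$ (i, j) = (\<Sum>k = 0..<m. (Q * entries A) $$ (i, k) * Cm $$ (k, j))"
      unfolding M_def Q_def[symmetric]
      by (rule index_mult_mat_sum[OF mult_carrier_mat[OF Q Acarr] _ ij]) (simp add: Cm_def)
    also have "\<dots> = (\<Sum>k = 0..<m. entries A $$ (P ! i, k) * val (col_vec (cols ! j) ! k))"
      by (rule sum.cong) (simp_all add: QA Cm_def ij)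
    also have "\<dots> = val (dot (rs ! (P ! i)) (col_vec (cols ! j)))"
      using rs_len Pn[OF ij(1)] vlen[OF ij(2)] rs_val
      by (simp add: val_dot m_def atLeast0LessThan)
    finally show ?thesis .
  qed
  have "reduced_hermite_form M"
  proof (rule reduced_hermite_formI[OF Mcarr, of "length ps"])
    show rn: "length ps \<le> n" using Plen by (simp add: P_def)
    show rm: "length ps \<le> m" using clen plen by (simp add: cols_def)
    show "M $$ (i, i) \<noteq> 0" if "i < length ps" for i
      using that rn rm diag plen by (simp add: M P_def cols_def nth_append)
    show "M $$ (i, j) = 0" if "i < j" "j < length ps" for i j
      using that rn rm upper plen by (simp add: M P_def cols_def nth_append)
    show "M $$ (i, j) = 0" if "i < n" "length ps \<le> j" "j < m" for i j
    proof -
      have "cols ! j \<in> set act" using that plen clen by (auto simp: cols_def nth_append)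
      then show ?thesis using zero Pn that by (simp add: M)
    qed
  qed
  then have "hermite_reduction A L C"
    unfolding hermite_reduction_def using Cinv perm
    by (auto simp: C_def L_def es hs n_def pmat_prod_def perm_pmat_def M_def intro!: exI[of _ \<sigma>])
  moreover have "mat_to_list L = us"
    unfolding us P_def[symmetric]
    by (intro nth_equalityI) (simp_all add: L_def perm_mat_def mat_to_list_def Plen u_def \<sigma>_def)
  moreover have "mat_to_list (entries C) = map (map val) cs"
  proof -
    have "cs = map (\<lambda>i. map (\<lambda>c. c ! i) (map col_vec cols)) [0..<length es]"
      unfolding cs by (rule transpose_cols) (use ok in \<open>auto simp: col_ok_def\<close>)
    then show ?thesis
      by (intro nth_equalityI) (auto simp: C_def Cm_def mat_to_list_def m_def clen intro!: nth_equalityI)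
  qed
  ultimately show ?thesis by (intro exI[of _ L] exI[of _ C]) (simp add: C_def es')
qed

section \<open>Computability of the reduction\<close>

lemma computes_dot [computes_intros]:
  assumes "computes idinv E (enc_list enc_quot) f" "computes idinv E (enc_list enc_quot) g"
  shows "computes idinv E enc_quot (\<lambda>x. dot (f x) (g x))"
  unfolding dot_def by (rule assms computes_intros)+

text \<open>The coefficients occur inside the function passed to \<open>map2\<close>, that is, in a
  larger environment where the assumptions do not match. So the parameters are first made
  projections of the input, and the given programs are composed afterwards. The same device recurs
  below.\<close>

lemma computes_lincomb [computes_intros]:
  assumes "computes idinv E enc_quot a" "computes idinv E enc_quot b"
    and "computes idinv E (enc_list enc_quot) f" "computes idinv E (enc_list enc_quot) g"
  shows "computes idinv E (enc_list enc_quot) (\<lambda>x. lincomb (a x) (b x) (f x) (g x))"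
proof -
  have "computes idinv (enc_pair (enc_pair enc_quot enc_quot) (enc_pair (enc_list enc_quot) (enc_list enc_quot)))
      (enc_list enc_quot) (\<lambda>z. lincomb (fst (fst z)) (snd (fst z)) (fst (snd z)) (snd (snd z)))"
    unfolding lincomb_def by (rule computes_intros)+
  from computes_comp[OF computes_Pair[OF computes_Pair[OF assms(1,2)] computes_Pair[OF assms(3,4)]] this]
  show ?thesis by simp
qed

lemma computes_products [computes_intros]:
  assumes "computes idinv E (enc_list enc_quot) f" "computes idinv E (enc_list enc_quot) g"
  shows "computes idinv E (enc_list enc_quot) (\<lambda>x. products (f x) (g x))"
proof -
  have "computes idinv (enc_pair (enc_list enc_quot) (enc_list enc_quot)) (enc_list enc_quot)
      (\<lambda>z. products (fst z) (snd z))"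
    unfolding products_def by (rule computes_intros)+
  from computes_comp[OF computes_Pair[OF assms] this] show ?thesis by simp
qed

lemma computes_common_denom [computes_intros]:
  assumes "computes idinv E (enc_list enc_quot) f"
  shows "computes idinv E (enc_pair (enc_list DElem) DElem) (\<lambda>x. common_denom (f x))"
  unfolding common_denom_def by (rule assms computes_intros)+

lemma computes_frac_inv:
  assumes "inverts_fg_ideals idinv" "computes idinv E (enc_list enc_quot) f"
  shows "computes idinv E (enc_list enc_quot) (\<lambda>x. frac_inv idinv (f x))"
  unfolding frac_inv_def by (rule assms computes_ideal_inv[OF assms(1)] computes_intros)+

abbreviation enc_col :: "'z::idom col \<Rightarrow> 'z datum" where
  "enc_col \<equiv> enc_pair (enc_list enc_quot) (enc_pair (enc_list enc_quot) (enc_list enc_quot))"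

lemma computes_combine:
  assumes inv: "inverts_fg_ideals idinv"
    and "computes idinv E enc_quot a" "computes idinv E enc_quot b"
    and "computes idinv E enc_col f" "computes idinv E enc_col g"
  shows "computes idinv E (enc_pair enc_col enc_col) (\<lambda>x. combine idinv (a x) (b x) (f x) (g x))"
proof -
  have "computes idinv (enc_pair (enc_pair enc_quot enc_quot) (enc_pair enc_col enc_col)) (enc_pair enc_col enc_col)
      (\<lambda>z. combine idinv (fst (fst z)) (snd (fst z)) (fst (snd z)) (snd (snd z)))"
    unfolding combine_def by (rule computes_frac_inv[OF inv] computes_intros)+
  from computes_comp[OF computes_Pair[OF computes_Pair[OF assms(2,3)] computes_Pair[OF assms(4,5)]] this]
  show ?thesis by simp
qed

lemma computes_sweep:
  assumes inv: "inverts_fg_ideals idinv"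
    and "computes idinv E (enc_list enc_quot) f" "computes idinv E (enc_list enc_col) g"
  shows "computes idinv E (enc_pair (enc_list enc_col) (enc_list enc_col)) (\<lambda>x. sweep idinv (f x) (g x))"
proof -
  have "computes idinv (enc_pair (enc_list enc_quot) (enc_list enc_col))
      (enc_pair (enc_list enc_col) (enc_list enc_col)) (\<lambda>z. sweep idinv (fst z) (snd z))"
    unfolding sweep_def sweep_step_def by (rule computes_combine[OF inv] computes_intros)+
  from computes_comp[OF computes_Pair[OF assms(2,3)] this] show ?thesis by simp
qed

abbreviation enc_rows :: "'z::idom quot list list \<Rightarrow> 'z datum" where
  "enc_rows \<equiv> enc_list (enc_list enc_quot)"

lemma computes_row_step:
  assumes inv: "inverts_fg_ideals idinv"
    and "computes idinv E (enc_pair (enc_list enc_quot) U) f"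
    and "computes idinv E (enc_pair (enc_list enc_col) (enc_pair (enc_list enc_col)
      (enc_pair (enc_list U) (enc_list U)))) g"
  shows "computes idinv E (enc_pair (enc_list enc_col) (enc_pair (enc_list enc_col)
      (enc_pair (enc_list U) (enc_list U)))) (\<lambda>x. row_step idinv (f x) (g x))"
proof -
  have "computes idinv (enc_pair (enc_pair (enc_list enc_quot) U) (enc_pair (enc_list enc_col)
      (enc_pair (enc_list enc_col) (enc_pair (enc_list U) (enc_list U)))))
      (enc_pair (enc_list enc_col) (enc_pair (enc_list enc_col) (enc_pair (enc_list U) (enc_list U))))
      (\<lambda>z. row_step idinv (fst z) (snd z))"
    unfolding row_step_def by (rule computes_sweep[OF inv] computes_intros)+
  from computes_comp[OF computes_Pair[OF assms(2,3)] this] show ?thesis by simp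
qed

lemma computes_unit_rows [computes_intros]:
  assumes "computes idinv E (enc_list A) f"
  shows "computes idinv E (enc_list (enc_list DElem)) (\<lambda>x. unit_rows (f x))"
  unfolding unit_rows_def by (rule assms computes_intros)+

lemma computes_init_cols [computes_intros]:
  assumes "computes idinv E enc_rows f"
  shows "computes idinv E (enc_list enc_col) (\<lambda>x. init_cols (f x))"
  unfolding init_cols_def by (rule assms computes_intros)+

lemma computes_transpose_cols [computes_intros]:
  assumes "computes idinv E (enc_list A) f" "computes idinv E (enc_list (enc_list B)) g"
  shows "computes idinv E (enc_list (enc_list B)) (\<lambda>x. transpose_cols (f x) (g x))"
  unfolding transpose_cols_def by (rule assms computes_intros)+

lemma computes_hermite:
  assumes inv: "inverts_fg_ideals idinv"
  shows "computes idinv (enc_pair enc_rows (enc_pair enc_rows enc_rows))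
    (enc_pair (enc_list (enc_list DElem)) (enc_pair enc_rows (enc_pair enc_rows enc_rows))) (hermite idinv)"
proof -
  have "computes idinv (enc_pair enc_rows (enc_pair enc_rows enc_rows))
    (enc_pair (enc_list (enc_list DElem)) (enc_pair enc_rows (enc_pair enc_rows enc_rows)))
    (\<lambda>d. hermite idinv d)"
    unfolding hermite_def by (rule computes_row_step[OF inv] computes_intros)+
  then show ?thesis by simp
qed

text \<open>If a representation relation consists of an encoding \<open>E\<close> of representatives
  and a value map \<open>v\<close>, so does its extension to lists. Applied repeatedly, this turns
  codes of pseudo-matrices into the encodings for which the program was built.\<close>

lemma codes_list_iff:
  assumes "\<And>d x. R d x \<longleftrightarrow> (\<exists>q. d = E q \<and> x = v q)"
  shows "codes_list R d xs \<longleftrightarrow> (\<exists>qs. d = enc_list E qs \<and> xs = map v qs)"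
proof -
  have "\<exists>qs. ds = map E qs \<and> xs = map v qs" if "list_all2 R ds xs" for ds
    using that
  proof (induction rule: list_all2_induct)
    case (Cons d ds x xs)
    then obtain q qs where "d = E q" "x = v q" "ds = map E qs" "xs = map v qs" using assms by blast
    then show ?case by (intro exI[of _ "q # qs"]) simp
  qed simp
  moreover have "list_all2 R (map E qs) (map v qs)" for qs
  proof (induction qs)
    case (Cons q qs)
    moreover have "R (E q) (v q)" using assms by blast
    ultimately show ?case by simp
  qed simp
  ultimately show ?thesis unfolding codes_list_def enc_list_def by blast
qed

lemma codes_frac_iff: "codes_frac d x \<longleftrightarrow> (\<exists>q. d = enc_quot q \<and> x = val q)"
proof
  assume "codes_frac d x"
  then obtain a b where "b \<noteq> 0" "d = frac_datum (a, b)" "x = Fract a b" by (auto simp: codes_frac_def)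
  then show "\<exists>q. d = enc_quot q \<and> x = val q"
    by (intro exI[of _ "mk_quot (a, b)"]) (simp add: val_mk_quot enc_quot_def mk_quot_inverse)
next
  assume "\<exists>q. d = enc_quot q \<and> x = val q"
  then show "codes_frac d x" by (auto simp: codes_frac_def enc_quot_eq frac_datum_def val_def)
qed

lemma codes_ideal_iff: "codes_ideal d I \<longleftrightarrow> (\<exists>us. d = enc_list enc_quot us \<and> I = gen us)"
  unfolding codes_ideal_def codes_list_iff[OF codes_frac_iff] by auto

lemma codes_mat_frac_iff:
  "codes_mat codes_frac d M \<longleftrightarrow> (\<exists>rs. d = enc_rows rs \<and> mat_to_list M = map (map val) rs)"
  unfolding codes_mat_def by (rule codes_list_iff[OF codes_list_iff[OF codes_frac_iff]])

lemma codes_mat_elem_iff: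
  "codes_mat codes_elem d M \<longleftrightarrow> d = enc_list (enc_list DElem) (mat_to_list M)"
proof -
  have "codes_elem d x \<longleftrightarrow> (\<exists>q. d = DElem q \<and> x = id q)" for d and x :: 'a
    by (simp add: codes_elem_def)
  from codes_list_iff[OF codes_list_iff[OF this]] show ?thesis unfolding codes_mat_def by auto
qed

lemma codes_pmat_iff:
  "codes_pmat d M \<longleftrightarrow> (\<exists>hs es rs. d = enc_pair enc_rows (enc_pair enc_rows enc_rows) (hs, es, rs) \<and>
     row_ideals M = map gen hs \<and> col_ideals M = map gen es \<and> mat_to_list (entries M) = map (map val) rs)"
  unfolding codes_pmat_def codes_mat_frac_iff codes_list_iff[OF codes_ideal_iff] by auto

theorem mainTheorem1:
  fixes idinv :: "'z::idom list \<Rightarrow> ('z \<times> 'z) list"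
  assumes "pruefer_domain TYPE('z)" and "inverts_fg_ideals idinv"
  shows "(\<forall>A :: 'z fract pmat. pseudo_matrix A \<longrightarrow> (\<exists>L C. hermite_reduction A L C)) \<and>
    (\<exists>p. \<forall>(A :: 'z fract pmat) d. pseudo_matrix A \<longrightarrow> codes_pmat d A \<longrightarrow>
       (\<exists>dL dC L C. runs idinv p d (DPair dL dC) \<and>
          codes_mat codes_elem dL L \<and> codes_pmat dC C \<and> hermite_reduction A L C))"
proof -
  \<comment> \<open>The program is fixed here, before any pseudo-matrix is considered.\<close>
  obtain p where p: "runs idinv p (enc_pair enc_rows (enc_pair enc_rows enc_rows) x)
      (enc_pair (enc_list (enc_list DElem)) (enc_pair enc_rows (enc_pair enc_rows enc_rows)) (hermite idinv x))" for x
    using computes_hermite[OF assms(2)] unfolding computes_def by blast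
  have alg: "\<exists>dL dC L C. runs idinv p d (DPair dL dC) \<and>
      codes_mat codes_elem dL L \<and> codes_pmat dC C \<and> hermite_reduction A L C"
    if A: "pseudo_matrix A" and d: "codes_pmat d A" for A :: "'z fract pmat" and d
  proof -
    obtain hs es rs where hs: "d = enc_pair enc_rows (enc_pair enc_rows enc_rows) (hs, es, rs)"
      "row_ideals A = map gen hs" "col_ideals A = map gen es" "mat_to_list (entries A) = map (map val) rs"
      using d unfolding codes_pmat_iff by blast
    obtain us es' gs cs where out: "hermite idinv (hs, es, rs) = (us, es', gs, cs)" by (metis prod_cases4)
    obtain L C where LC: "hermite_reduction A L C" "mat_to_list L = us" "row_ideals C = map gen es'"
      "col_ideals C = map gen gs" "mat_to_list (entries C) = map (map val) cs"
      using hermite_correct[OF assms(2) A hs(2-4) out] by blast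
    have "runs idinv p d (DPair (enc_list (enc_list DElem) us)
        (enc_pair enc_rows (enc_pair enc_rows enc_rows) (es', gs, cs)))"
      using p[of "(hs, es, rs)"] hs(1) out by simp
    moreover have "codes_mat codes_elem (enc_list (enc_list DElem) us) L"
      by (simp add: codes_mat_elem_iff LC(2))
    moreover have "codes_pmat (enc_pair enc_rows (enc_pair enc_rows enc_rows) (es', gs, cs)) C"
      unfolding codes_pmat_iff using LC(3-5) by blast
    ultimately show ?thesis using LC(1) by blast
  qed
  \<comment> \<open>Every pseudo-matrix has a code, so plain existence follows from the
    algorithm.\<close>
  then show ?thesis using codes_pmat_exists by blast
qed

end
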